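(* The equational classes $\mathcal{F}_{g,p}$ (pointed FG-quasigroups) and $\mathcal{M}_p$ (pointed central generalized $\mathbf{R}$-modules in $\mathcal{M}$) are equivalent. This equivalence restricts to an equivalence between $\mathcal{F}_{g,m}$ and $\mathcal{M}_c$.
   Context: A quasigroup is a non-empty set $Q$ with a binary operation (written multiplicatively) such that all left translations $L_a:x\mapsto ax$ and all right translations $R_a:x\mapsto xa$ are permutations of $Q$. Juxtaposition binds more tightly than $\cdot$, so $xy\cdot zw$ means $(xy)(zw)$. In a quasigroup the maps $\alpha,\beta:Q\to Q$ are defined by $x\,\alpha(x)=x=\beta(x)\,x$. $Q$ is a left F-quasigroup if $x\cdot yz = xy\cdot\alpha(x)z$ for all $x,y,z\in Q$; a right F-quasigroup if $zy\cdot x = z\beta(x)\cdot yx$ for all $x,y,z\in Q$; an F-quasigroup if it is both. A quasigroup $(Q,\cdot)$ is isotopic to a group $(G,+)$ if there are bijections $a,b,c:Q\to G$ with $c(xy)=a(x)+b(y)$ for all $x,y\in Q$. An FG-quasigroup is an F-quasigroup isotopic to a (possibly noncommutative) group. Groups are written additively even when noncommutative; $Z(G,+)$ denotes the center of $(G,+)$. For a quasigroup $Q$ put $M(Q)=\{a\in Q:\ xa\cdot yx=xy\cdot ax\ \text{ for all } x,y\in Q\}$. $\mathcal{F}_{g,p}$ is the class (and category) of pairs $(Q,a)$ with $Q$ an FG-quasigroup and $a\in Q$; a homomorphism $(Q,a)\to(P,b)$ is a quasigroup homomorphism $\varphi:Q\to P$ with $\varphi(a)=b$. $\mathcal{F}_{g,m}$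 is the full subclass of those $(Q,a)\in\mathcal{F}_{g,p}$ with $a\in M(Q)$. For an associative ring $R$ (with or without unity), a central generalized (left) $R$-module is a (possibly noncommutative) group $(G,+)$ with a scalar multiplication $R\times G\to G$ such that $a(x+y)=ax+ay$, $(a+b)x=ax+bx$, $a(bx)=(ab)x$ and $ax\in Z(G,+)$ for all $a,b\in R$, $x,y\in G$. Its annihilator is $\mathrm{Ann}(G)=\{a\in R: aG=0\}$. Homomorphisms of such modules are group homomorphisms commuting with the scalar multiplication. Let $\mathbf{S}=\mathbb{Z}[\mathbf{x},\mathbf{y},\mathbf{u},\mathbf{v}]$ be the polynomial ring in four commuting indeterminates over the integers and let $\mathbf{R}=\mathbf{S}\mathbf{x}+\mathbf{S}\mathbf{y}+\mathbf{S}\mathbf{u}+\mathbf{S}\mathbf{v}$ be the ideal generated by the indeterminates, regarded as a commutative associative ring without unity. $\mathcal{M}$ is the class (and category) of central generalized $\mathbf{R}$-modules $G$ such that $\mathbf{x}+\mathbf{u}+\mathbf{x}\mathbf{u}\in\mathrm{Ann}(G)$ and $\mathbf{y}+\mathbf{v}+\mathbf{y}\mathbf{v}\in\mathrm{Ann}(G)$. $\mathcal{M}_p$ is the class of pairs $(G,e)$ with $G\in\mathcal{M}$ and $e\in G$, with homomorphisms the module homomorphisms preserving the distinguished element. $\mathcal{M}_c$ is the subclass of those $(G,e)\in\mathcal{M}_p$ with $e\in Z(G,+)$. Two such classes $\mathcal{A},\mathcal{B}$ are called equivalent if there is a biunique (one-to-one and onto) correspondence $\Phi:\mathcal{A}\to\mathcal{B}$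 such that for every $A\in\mathcal{A}$ the algebras $A$ and $\Phi(A)$ have the same underlying set, and for all $A,B\in\mathcal{A}$ a mapping $\varphi:A\to B$ is an $\mathcal{A}$-homomorphism $A\to B$ if and only if it is a $\mathcal{B}$-homomorphism $\Phi(A)\to\Phi(B)$. *)

theory Defs
  imports "HOL-Algebra.Group" "HOL-Library.Poly_Mapping"
begin

section \<open>Quasigroups\<close>

record 'a magma = "'a partial_object" +
  op :: "'a \<Rightarrow> 'a \<Rightarrow> 'a" (infixl "\<cdot>\<index>" 70)

text \<open>
  Algebras are records with an explicit carrier inside a type \<open>'a\<close>. All operations are required to
  be \<open>undefined\<close> outside the carrier, so that two records are equal iff they
  represent the same algebra; otherwise a one-to-one correspondence between classes of
  algebras would count junk values.
\<close>

locale quasigroup =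
  fixes Q :: "'a magma" (structure)
  assumes nonempty: "carrier Q \<noteq> {}"
    and left_translation: "a \<in> carrier Q \<Longrightarrow> bij_betw (\<lambda>x. a \<cdot> x) (carrier Q) (carrier Q)"
    and right_translation: "a \<in> carrier Q \<Longrightarrow> bij_betw (\<lambda>x. x \<cdot> a) (carrier Q) (carrier Q)"
    and op_undefined: "x \<notin> carrier Q \<or> y \<notin> carrier Q \<Longrightarrow> x \<cdot> y = undefined"

definition local_right_unit :: "'a magma \<Rightarrow> 'a \<Rightarrow> 'a" ("\<alpha>\<index>")
  where "\<alpha>\<^bsub>Q\<^esub> x = (THE z. z \<in> carrier Q \<and> x \<cdot>\<^bsub>Q\<^esub> z = x)"

definition local_left_unit :: "'a magma \<Rightarrow> 'a \<Rightarrow> 'a" ("\<beta>\<index>")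
  where "\<beta>\<^bsub>Q\<^esub> x = (THE z. z \<in> carrier Q \<and> z \<cdot>\<^bsub>Q\<^esub> x = x)"

locale left_F_quasigroup = quasigroup +
  assumes left_F: "\<lbrakk>x \<in> carrier Q; y \<in> carrier Q; z \<in> carrier Q\<rbrakk>
    \<Longrightarrow> x \<cdot> (y \<cdot> z) = (x \<cdot> y) \<cdot> (\<alpha> x \<cdot> z)"

locale right_F_quasigroup = quasigroup +
  assumes right_F: "\<lbrakk>x \<in> carrier Q; y \<in> carrier Q; z \<in> carrier Q\<rbrakk>
    \<Longrightarrow> (z \<cdot> y) \<cdot> x = (z \<cdot> \<beta> x) \<cdot> (y \<cdot> x)"

locale F_quasigroup = left_F_quasigroup + right_F_quasigroup

definition isotopic :: "'a magma \<Rightarrow> ('b, 'm) monoid_scheme \<Rightarrow> bool"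
  where "isotopic Q G \<longleftrightarrow> (\<exists>a b c.
    bij_betw a (carrier Q) (carrier G) \<and>
    bij_betw b (carrier Q) (carrier G) \<and>
    bij_betw c (carrier Q) (carrier G) \<and>
    (\<forall>x\<in>carrier Q. \<forall>y\<in>carrier Q. c (x \<cdot>\<^bsub>Q\<^esub> y) = a x \<otimes>\<^bsub>G\<^esub> b y))"

text \<open>
  Letting \<open>G\<close> range only over groups inside the type \<open>'a\<close> is no restriction: a group isotopic
  to \<open>Q\<close> is in bijection with \<open>carrier Q\<close> and can be transported to it.
\<close>

locale FG_quasigroup = F_quasigroup Q for Q :: "'a magma" (structure) +
  assumes isotopic_to_group: "\<exists>G :: 'a monoid. group G \<and> isotopic Q G"

definition M_set :: "'a magma \<Rightarrow> 'a set"
  where "M_set Q = {a \<in> carrier Q. \<forall>x\<in>carrier Q. \<forall>y\<in>carrier Q.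
    (x \<cdot>\<^bsub>Q\<^esub> a) \<cdot>\<^bsub>Q\<^esub> (y \<cdot>\<^bsub>Q\<^esub> x) = (x \<cdot>\<^bsub>Q\<^esub> y) \<cdot>\<^bsub>Q\<^esub> (a \<cdot>\<^bsub>Q\<^esub> x)}"

type_synonym 'a pointed_magma = "'a magma \<times> 'a"

definition F_gp :: "'a pointed_magma set"
  where "F_gp = {(Q, a). FG_quasigroup Q \<and> a \<in> carrier Q}"

definition F_gm :: "'a pointed_magma set"
  where "F_gm = {(Q, a) \<in> F_gp. a \<in> M_set Q}"

definition pointed_quasigroup_hom ::
    "'a pointed_magma \<Rightarrow> 'b pointed_magma \<Rightarrow> ('a \<Rightarrow> 'b) \<Rightarrow> bool"
  where "pointed_quasigroup_hom = (\<lambda>(Q, a) (P, b) \<phi>.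
    \<phi> \<in> carrier Q \<rightarrow> carrier P \<and>
    (\<forall>x\<in>carrier Q. \<forall>y\<in>carrier Q. \<phi> (x \<cdot>\<^bsub>Q\<^esub> y) = \<phi> x \<cdot>\<^bsub>P\<^esub> \<phi> y) \<and>
    \<phi> a = b)"


section \<open>Central generalized modules\<close>

text \<open>
  A ring without unity is given as a subset \<open>R\<close> of a type of class \<open>ring\<close> (which does not
  require a unity), closed under the ring operations. The possibly noncommutative group is a
  multiplicatively written group of \<open>HOL-Algebra\<close>: its \<open>\<otimes>\<close> and \<open>\<one>\<close> are the \<open>+\<close> and \<open>0\<close> of the
  module.
\<close>

definition subrng :: "'r::ring set \<Rightarrow> bool"
  where "subrng R \<longleftrightarrow>
    0 \<in> R \<and> (\<forall>a\<in>R. \<forall>b\<in>R. a + b \<in> R \<and> a * b \<in> R) \<and> (\<forall>a\<in>R. - a \<in> R)"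

record ('r, 'a) gmodule = "'a monoid" +
  scale :: "'r \<Rightarrow> 'a \<Rightarrow> 'a" (infixr "\<bullet>\<index>" 75)

definition group_center :: "('a, 'm) monoid_scheme \<Rightarrow> 'a set"
  where "group_center G = {z \<in> carrier G. \<forall>x\<in>carrier G. z \<otimes>\<^bsub>G\<^esub> x = x \<otimes>\<^bsub>G\<^esub> z}"

locale central_generalized_module = group G
  for R :: "'r::ring set" and G :: "('r, 'a) gmodule" (structure) +
  assumes scalar_ring: "subrng R"
    and scale_add_right: "\<lbrakk>a \<in> R; x \<in> carrier G; y \<in> carrier G\<rbrakk>
      \<Longrightarrow> a \<bullet> (x \<otimes> y) = (a \<bullet> x) \<otimes> (a \<bullet> y)"
    and scale_add_left: "\<lbrakk>a \<in> R; b \<in> R; x \<in> carrier G\<rbrakk>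
      \<Longrightarrow> (a + b) \<bullet> x = (a \<bullet> x) \<otimes> (b \<bullet> x)"
    and scale_scale: "\<lbrakk>a \<in> R; b \<in> R; x \<in> carrier G\<rbrakk> \<Longrightarrow> a \<bullet> (b \<bullet> x) = (a * b) \<bullet> x"
    and scale_central: "\<lbrakk>a \<in> R; x \<in> carrier G\<rbrakk> \<Longrightarrow> a \<bullet> x \<in> group_center G"
    and add_undefined: "x \<notin> carrier G \<or> y \<notin> carrier G \<Longrightarrow> x \<otimes> y = undefined"
    and scale_undefined: "a \<notin> R \<or> x \<notin> carrier G \<Longrightarrow> a \<bullet> x = undefined"

definition annihilator :: "'r set \<Rightarrow> ('r, 'a) gmodule \<Rightarrow> 'r set"
  where "annihilator R G = {a \<in> R. \<forall>x\<in>carrier G. a \<bullet>\<^bsub>G\<^esub> x = \<one>\<^bsub>G\<^esub>}"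

definition gmodule_hom ::
    "'r set \<Rightarrow> ('r, 'a) gmodule \<Rightarrow> ('r, 'b) gmodule \<Rightarrow> ('a \<Rightarrow> 'b) \<Rightarrow> bool"
  where "gmodule_hom R G H \<phi> \<longleftrightarrow>
    \<phi> \<in> hom G H \<and> (\<forall>a\<in>R. \<forall>x\<in>carrier G. \<phi> (a \<bullet>\<^bsub>G\<^esub> x) = a \<bullet>\<^bsub>H\<^esub> \<phi> x)"


section \<open>The scalar ring and the class of modules\<close>

datatype indeterminate = X | Y | U | V

text \<open>
  The polynomial ring in four commuting indeterminates over the integers: finitely supported
  integer coefficients on finitely supported exponent functions, with convolution as product.
\<close>

type_synonym poly_S = "(indeterminate \<Rightarrow>\<^sub>0 nat) \<Rightarrow>\<^sub>0 int"

definition indet :: "indeterminate \<Rightarrow> poly_S"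
  where "indet i = Poly_Mapping.single (Poly_Mapping.single i 1) 1"

definition ideal_R :: "poly_S set"
  where "ideal_R = {a * indet X + b * indet Y + c * indet U + d * indet V | a b c d. True}"

lemma subrng_ideal_R: "subrng ideal_R"
proof -
  have add: "p + q \<in> ideal_R" if "p \<in> ideal_R" "q \<in> ideal_R" for p q
  proof -
    from that obtain a b c d a' b' c' d' where
      "p = a * indet X + b * indet Y + c * indet U + d * indet V"
      "q = a' * indet X + b' * indet Y + c' * indet U + d' * indet V"
      unfolding ideal_R_def by blast
    then have "p + q = (a + a') * indet X + (b + b') * indet Y + (c + c') * indet U + (d + d') * indet V"
      by (simp add: algebra_simps)
    then show ?thesis unfolding ideal_R_def by blast
  qed
  have mult: "s * p \<in> ideal_R" if "p \<in> ideal_R" for s p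
  proof -
    from that obtain a b c d where "p = a * indet X + b * indet Y + c * indet U + d * indet V"
      unfolding ideal_R_def by blast
    then have "s * p = (s * a) * indet X + (s * b) * indet Y + (s * c) * indet U + (s * d) * indet V"
      by (simp add: algebra_simps)
    then show ?thesis unfolding ideal_R_def by blast
  qed
  have "0 = 0 * indet X + 0 * indet Y + 0 * indet U + 0 * indet V" by simp
  then have zero: "0 \<in> ideal_R" unfolding ideal_R_def by blast
  have "- p \<in> ideal_R" if "p \<in> ideal_R" for p
    using mult[OF that, of "- 1"] by simp
  then show ?thesis unfolding subrng_def using zero add mult by blast
qed

type_synonym 'a R_module = "(poly_S, 'a) gmodule"

definition M_class :: "'a R_module set"
  where "M_class = {G. central_generalized_module ideal_R G \<and>
    indet X + indet U + indet X * indet U \<in> annihilator ideal_R G \<and>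
    indet Y + indet V + indet Y * indet V \<in> annihilator ideal_R G}"

type_synonym 'a pointed_R_module = "'a R_module \<times> 'a"

definition M_p :: "'a pointed_R_module set"
  where "M_p = {(G, e). G \<in> M_class \<and> e \<in> carrier G}"

definition M_c :: "'a pointed_R_module set"
  where "M_c = {(G, e) \<in> M_p. e \<in> group_center G}"

definition pointed_R_module_hom ::
    "'a pointed_R_module \<Rightarrow> 'b pointed_R_module \<Rightarrow> ('a \<Rightarrow> 'b) \<Rightarrow> bool"
  where "pointed_R_module_hom = (\<lambda>(G, e) (H, f) \<phi>. gmodule_hom ideal_R G H \<phi> \<and> \<phi> e = f)"


section \<open>Equivalence of classes of algebras\<close>

text \<open>
  A class of algebras is given by a set \<open>A\<close> of algebras, a function \<open>car\<close> assigning
  underlying sets, and a predicate \<open>mor\<close> singling out the homomorphisms.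
\<close>

definition class_equivalence ::
    "('s \<Rightarrow> 'a set) \<Rightarrow> ('s \<Rightarrow> 's \<Rightarrow> ('a \<Rightarrow> 'a) \<Rightarrow> bool) \<Rightarrow>
     ('t \<Rightarrow> 'a set) \<Rightarrow> ('t \<Rightarrow> 't \<Rightarrow> ('a \<Rightarrow> 'a) \<Rightarrow> bool) \<Rightarrow>
     's set \<Rightarrow> 't set \<Rightarrow> ('s \<Rightarrow> 't) \<Rightarrow> bool"
  where "class_equivalence car mor car' mor' \<A> \<B> \<Phi> \<longleftrightarrow>
    bij_betw \<Phi> \<A> \<B> \<and>
    (\<forall>A\<in>\<A>. car' (\<Phi> A) = car A) \<and>
    (\<forall>A\<in>\<A>. \<forall>B\<in>\<A>. \<forall>\<phi> \<in> car A \<rightarrow> car B. mor A B \<phi> \<longleftrightarrow> mor' (\<Phi> A) (\<Phi> B) \<phi>)"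

abbreviation pointed_class_equivalence ::
    "'a pointed_magma set \<Rightarrow> 'a pointed_R_module set \<Rightarrow>
     ('a pointed_magma \<Rightarrow> 'a pointed_R_module) \<Rightarrow> bool"
  where "pointed_class_equivalence \<equiv> class_equivalence
    (\<lambda>(Q, a). carrier Q) pointed_quasigroup_hom
    (\<lambda>(G, e). carrier G) pointed_R_module_hom"

end

theory Submission
  imports Defs "HOL-Algebra.Free_Abelian_Groups"
begin

text \<open>
  Both sides of the equivalence describe the same data: a group with two commuting automorphisms
  \<open>f\<close>, \<open>g\<close> such that \<open>- x + f x\<close> and \<open>- x + g x\<close> are always central, together with an element \<open>e\<close>.
  (Groups are written additively in the comments, multiplicatively in the formal text; \<open>0\<close>
  stands for the neutral element.)

  On the side of modules, the scalars \<open>X\<close> and \<open>Y\<close> act as \<open>f - 1\<close> and \<open>g - 1\<close>, and the annihilator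
  conditions say \<open>(1 + X) (1 + U) = 1\<close> and \<open>(1 + Y) (1 + V) = 1\<close>, so that \<open>U\<close> and \<open>V\<close> encode the
  inverses of \<open>f\<close> and \<open>g\<close>. Conversely, commuting endomorphisms with central values can be
  substituted for the indeterminates of a polynomial without constant term
  (\<open>polynomial_action\<close>, \<open>ex_module\<close>).

  On the side of quasigroups, the data give the operation \<open>x \<cdot> y = f x + e + g y\<close> with base point \<open>0\<close>.
  Centrality makes this an FG-quasigroup (\<open>FG_affine_quasigroup\<close>). Conversely, the group
  isotopic to an FG-quasigroup can be moved so that its neutral element is the base point; the F-laws
  then force the operation to have this form (\<open>affine_form\<close>), with \<open>f\<close> and \<open>g\<close> commuting and
  central (\<open>affine_imp_central\<close>).

  A map that preserves the base points respects \<open>f x + e + g y\<close> iff it respects addition, \<open>f\<close>,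
  \<open>g\<close> and \<open>e\<close> (\<open>quasigroup_hom_imp_module_hom\<close>, \<open>module_hom_imp_quasigroup_hom\<close>). This gives the
  agreement of homomorphisms, and also the injectivity of the correspondence. Finally \<open>0\<close> lies in
  \<open>M_set\<close> of the quasigroup iff \<open>e\<close> is central (\<open>M_set_affine_quasigroup\<close>), which is the
  statement about the subclasses.
\<close>

section \<open>Central automorphisms of a group\<close>

context group
begin

lemma inv_m_cancel [simp]:
  "\<lbrakk>x \<in> carrier G; y \<in> carrier G\<rbrakk> \<Longrightarrow> inv x \<otimes> (x \<otimes> y) = y"
  "\<lbrakk>x \<in> carrier G; y \<in> carrier G\<rbrakk> \<Longrightarrow> x \<otimes> (inv x \<otimes> y) = y"
  by (simp_all add: m_assoc [symmetric])

lemma center_carrier: "z \<in> group_center G \<Longrightarrow> z \<in> carrier G"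
  by (simp add: group_center_def)

lemma center_comm: "\<lbrakk>z \<in> group_center G; x \<in> carrier G\<rbrakk> \<Longrightarrow> x \<otimes> z = z \<otimes> x"
  by (simp add: group_center_def)

lemma center_lcomm:
  "\<lbrakk>z \<in> group_center G; x \<in> carrier G; y \<in> carrier G\<rbrakk> \<Longrightarrow> x \<otimes> (z \<otimes> y) = z \<otimes> (x \<otimes> y)"
  using center_comm[of z x] center_carrier[of z] by (metis m_assoc)

lemma center_one: "\<one> \<in> group_center G"
  by (simp add: group_center_def)

lemma center_mult:
  assumes "z \<in> group_center G" "w \<in> group_center G"
  shows "z \<otimes> w \<in> group_center G"
proof -
  note cl = assms[THEN center_carrier]
  have "z \<otimes> w \<otimes> x = x \<otimes> (z \<otimes> w)" if x: "x \<in> carrier G" for x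
  proof -
    have "z \<otimes> w \<otimes> x = z \<otimes> (w \<otimes> x)"
      using cl x by (simp add: m_assoc)
    also have "w \<otimes> x = x \<otimes> w"
      using center_comm[OF assms(2) x] by (rule sym)
    also have "z \<otimes> (x \<otimes> w) = x \<otimes> (z \<otimes> w)"
      using center_lcomm[OF assms(1) x cl(2)] by (rule sym)
    finally show ?thesis .
  qed
  then show ?thesis
    using cl by (simp add: group_center_def)
qed

lemma center_inv:
  assumes "z \<in> group_center G"
  shows "inv z \<in> group_center G"
proof -
  have z: "z \<in> carrier G"
    using assms by (rule center_carrier)
  have "inv z \<otimes> x = x \<otimes> inv z" if x: "x \<in> carrier G" for x
  proof -
    have "inv z \<otimes> (x \<otimes> z) \<otimes> inv z = inv z \<otimes> (z \<otimes> x) \<otimes> inv z"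
      using center_comm[OF assms x] by simp
    then show ?thesis
      using x z by (simp add: m_assoc)
  qed
  then show ?thesis
    using z by (simp add: group_center_def)
qed

lemma comm_group_center: "comm_group (G\<lparr>carrier := group_center G\<rparr>)"
proof -
  have "subgroup (group_center G) G"
    by (rule subgroupI) (use center_carrier center_one center_mult center_inv in auto)
  then interpret Z: group "G\<lparr>carrier := group_center G\<rparr>"
    by (rule subgroup.subgroup_is_group) (rule group_axioms)
  show ?thesis
    by (rule Z.group_comm_groupI) (simp add: center_comm center_carrier)
qed

end

text \<open>
  The map \<open>f - 1\<close> of additive notation. The indeterminates of the scalar ring will act as the
  displacements of two commuting automorphisms and of their inverses.
\<close>

definition displacement :: "('a, 'm) monoid_scheme \<Rightarrow> ('a \<Rightarrow> 'a) \<Rightarrow> 'a \<Rightarrow> 'a"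
  where "displacement G f x = inv\<^bsub>G\<^esub> x \<otimes>\<^bsub>G\<^esub> f x"

definition central_automorphism :: "('a, 'm) monoid_scheme \<Rightarrow> ('a \<Rightarrow> 'a) \<Rightarrow> bool"
  where "central_automorphism G f \<longleftrightarrow>
    f \<in> iso G G \<and> (\<forall>x\<in>carrier G. displacement G f x \<in> group_center G)"

context group
begin

lemma central_automorphism_hom:
  assumes "central_automorphism G f"
  shows "f \<in> hom G G"
  using assms by (simp add: central_automorphism_def iso_def)

lemma central_automorphism_bij:
  assumes "central_automorphism G f"
  shows "bij_betw f (carrier G) (carrier G)"
  using assms by (simp add: central_automorphism_def iso_def)

lemma central_automorphism_closed:
  assumes "central_automorphism G f" "x \<in> carrier G"
  shows "f x \<in> carrier G"
  using central_automorphism_hom[OF assms(1)] assms(2) by (rule hom_in_carrier)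

lemma displacement_central:
  "\<lbrakk>central_automorphism G f; x \<in> carrier G\<rbrakk> \<Longrightarrow> displacement G f x \<in> group_center G"
  by (simp add: central_automorphism_def)

lemma m_displacement:
  "\<lbrakk>central_automorphism G f; x \<in> carrier G\<rbrakk> \<Longrightarrow> x \<otimes> displacement G f x = f x"
  by (simp add: displacement_def central_automorphism_closed)

lemma central_automorphism_mult:
  "\<lbrakk>central_automorphism G f; x \<in> carrier G; y \<in> carrier G\<rbrakk> \<Longrightarrow> f (x \<otimes> y) = f x \<otimes> f y"
  using central_automorphism_hom by (simp add: hom_mult)

lemma hom_self_inv:
  assumes "f \<in> hom G G" "x \<in> carrier G"
  shows "f (inv x) = inv (f x)"
proof -
  interpret group_hom G G f
    by unfold_locales (rule assms(1))
  show ?thesis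
    using assms(2) by simp
qed

lemma hom_self_one:
  assumes "f \<in> hom G G"
  shows "f \<one> = \<one>"
  using assms by (simp add: hom_one group_axioms)

text \<open>
  The displacement of \<open>x + y\<close> is \<open>- y + (- x + f x) + f y\<close>, and the part in parentheses, being central,
  moves to the front.
\<close>

lemma displacement_hom:
  assumes f: "central_automorphism G f"
  shows "displacement G f \<in> hom G G"
proof (rule homI)
  fix x y assume x: "x \<in> carrier G" and y: "y \<in> carrier G"
  note c = displacement_central[OF f x] and d = displacement_central[OF f y]
  have "inv (x \<otimes> y) \<otimes> f (x \<otimes> y) = inv y \<otimes> (displacement G f x \<otimes> f y)"
    using f x y
    by (simp add: displacement_def central_automorphism_mult central_automorphism_closed
        m_assoc inv_mult_group)
  also have "\<dots> = displacement G f x \<otimes> (inv y \<otimes> f y)"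
    using center_lcomm[OF c, of "inv y" "f y"] f y by (simp add: central_automorphism_closed)
  finally show "displacement G f (x \<otimes> y) = displacement G f x \<otimes> displacement G f y"
    by (simp add: displacement_def)
qed (simp add: displacement_def assms central_automorphism_closed)

text \<open>
  If \<open>f\<close> and \<open>h\<close> are \<open>1 + d\<close> and \<open>1 + d'\<close>, then \<open>f h = 1\<close> expands to \<open>d + d' + d d' = 0\<close>. This is
  the relation that the annihilator is required to contain.
\<close>

lemma displacement_inverse_relation:
  assumes f: "central_automorphism G f" and h: "central_automorphism G h"
    and inverse: "\<And>x. x \<in> carrier G \<Longrightarrow> f (h x) = x" and x: "x \<in> carrier G"
  shows "displacement G f x \<otimes> displacement G h x \<otimes> displacement G f (displacement G h x) = \<one>"
proof -
  define d where "d = displacement G h x"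
  have d: "d \<in> carrier G"
    using displacement_central[OF h x] by (simp add: d_def center_carrier)
  have "f d = inv (f x) \<otimes> x"
    using x f h
    by (simp add: d_def displacement_def central_automorphism_mult central_automorphism_closed
        hom_self_inv central_automorphism_hom inverse)
  then show ?thesis
    unfolding d_def[symmetric] using x d f
    by (simp add: displacement_def[of G f] m_assoc central_automorphism_closed)
qed

text \<open>
  At the point \<open>f y\<close> the displacement of the inverse automorphism is the inverse of the
  displacement of \<open>f\<close> at \<open>y\<close>, hence again central.
\<close>

lemma inverse_central_automorphism:
  assumes f: "central_automorphism G f"
  shows "central_automorphism G (inv_into (carrier G) f)" (is "central_automorphism G ?h")
proof -
  have iso: "f \<in> iso G G"
    using f by (simp add: central_automorphism_def)
  have "displacement G ?h x \<in> group_center G" if x: "x \<in> carrier G" for x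
  proof -
    define y where "y = ?h x"
    have y: "y \<in> carrier G" and x_y: "x = f y"
      using x central_automorphism_bij[OF f]
      by (auto simp: y_def bij_betw_def f_inv_into_f inv_into_into)
    have "displacement G ?h x = inv (displacement G f y)"
      using y f by (simp add: displacement_def flip: y_def)
        (simp add: x_y inv_mult_group central_automorphism_closed)
    then show ?thesis
      using center_inv displacement_central[OF f y] by simp
  qed
  then show ?thesis
    using iso_set_sym[OF iso] by (simp add: central_automorphism_def)
qed

text \<open>
  Either composite of the displacements \<open>d\<close> of \<open>f\<close> and \<open>d'\<close> of \<open>g\<close> can be written, additively, as
  \<open>- d' x - d x - x + f (g x)\<close>. This is symmetric in \<open>f\<close> and \<open>g\<close>, because \<open>d x\<close> is central.
\<close>

lemma displacement_commute:
  assumes f: "central_automorphism G f" and g: "central_automorphism G g"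
    and comm: "f (g x) = g (f x)" and x: "x \<in> carrier G"
  shows "displacement G f (displacement G g x) = displacement G g (displacement G f x)"
proof -
  have *: "displacement G f (displacement G g x)
      = inv (displacement G g x) \<otimes> inv (displacement G f x) \<otimes> (inv x \<otimes> f (g x))"
    if f: "central_automorphism G f" and g: "central_automorphism G g" for f g
  proof -
    have cl: "f x \<in> carrier G" "g x \<in> carrier G" "f (g x) \<in> carrier G"
      using f g x by (simp_all add: central_automorphism_closed)
    have "displacement G f (displacement G g x)
      = inv (displacement G g x) \<otimes> (inv (f x) \<otimes> f (g x))"
      using f g x cl by (simp add: displacement_def central_automorphism_mult
        hom_self_inv central_automorphism_hom)
    also have "inv (f x) = inv (displacement G f x) \<otimes> inv x"
    proof -
      have "displacement G f x \<in> group_center G"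
        using f x by (rule displacement_central)
      then have "x \<otimes> displacement G f x = displacement G f x \<otimes> x"
        using x by (rule center_comm)
      then have "f x = displacement G f x \<otimes> x"
        using m_displacement[OF f x] by simp
      then show ?thesis
        using x cl center_comm[OF center_inv[OF displacement_central[OF f x]], of "inv x"]
        by (simp add: inv_mult_group displacement_central[OF f x] center_carrier)
    qed
    finally show ?thesis
      using x cl by (simp add: m_assoc center_carrier displacement_central[OF f x]
          displacement_central[OF g x])
  qed
  show ?thesis
    unfolding *[OF f g] *[OF g f] comm
    using center_comm[OF center_inv[OF displacement_central[OF f x]]]
      center_carrier[OF center_inv[OF displacement_central[OF g x]]]
    by simp
qed

end

section \<open>The scalar ring is generated by the indeterminates\<close>

lemma exponent_cases:
  fixes k :: "indeterminate \<Rightarrow>\<^sub>0 nat"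
  assumes "k \<noteq> 0"
  obtains l i where "k = l + Poly_Mapping.single i 1"
proof -
  obtain i where "Poly_Mapping.lookup k i \<noteq> 0"
    using assms by (metis lookup_zero poly_mapping_eqI)
  then have "k = (k - Poly_Mapping.single i 1) + Poly_Mapping.single i 1"
    by (intro poly_mapping_eqI) (auto simp: lookup_add lookup_minus lookup_single when_def)
  then show ?thesis
    by (rule that)
qed

lemma exponent_induct [consumes 1, case_names single add_single]:
  fixes k :: "indeterminate \<Rightarrow>\<^sub>0 nat"
  assumes "k \<noteq> 0"
    and single: "\<And>i. P (Poly_Mapping.single i 1)"
    and add_single: "\<And>k i. \<lbrakk>k \<noteq> 0; P k\<rbrakk> \<Longrightarrow> P (k + Poly_Mapping.single i 1)"
  shows "P k"
proof -
  define deg where "deg k = Poly_Mapping.lookup k X + Poly_Mapping.lookup k Y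
    + Poly_Mapping.lookup k U + Poly_Mapping.lookup k V" for k :: "indeterminate \<Rightarrow>\<^sub>0 nat"
  have deg: "deg (l + Poly_Mapping.single i 1) = Suc (deg l)" for l i
    by (cases i) (simp_all add: deg_def lookup_add lookup_single)
  show ?thesis
    using assms(1)
  proof (induction "deg k" arbitrary: k rule: less_induct)
    case less
    obtain l i where k: "k = l + Poly_Mapping.single i 1"
      using less.prems by (rule exponent_cases)
    show ?case
    proof (cases "l = 0")
      case True
      then show ?thesis
        using single k by simp
    next
      case False
      then have "P l"
        using less.hyps k deg by simp
      then show ?thesis
        using add_single[OF False] k by simp
    qed
  qed
qed

lemma frag_of_mult_indet:
  "frag_of (k :: indeterminate \<Rightarrow>\<^sub>0 nat) * indet i = frag_of (k + Poly_Mapping.single i 1)"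
  by (simp add: indet_def mult_single)

lemma frag_of_single: "frag_of (Poly_Mapping.single i (Suc 0)) = indet i"
  by (simp add: indet_def)

lemma mult_indet_in_ideal_R: "s * indet i \<in> ideal_R"
proof -
  have "s * indet i = (if i = X then s else 0) * indet X + (if i = Y then s else 0) * indet Y
     + (if i = U then s else 0) * indet U + (if i = V then s else 0) * indet V"
    by (cases i) simp_all
  then show ?thesis
    unfolding ideal_R_def by blast
qed

lemma indet_in_ideal_R: "indet i \<in> ideal_R"
  using mult_indet_in_ideal_R[of 1 i] by simp

lemma ideal_R_closed:
  "0 \<in> ideal_R" "\<lbrakk>r \<in> ideal_R; s \<in> ideal_R\<rbrakk> \<Longrightarrow> r + s \<in> ideal_R"
  "\<lbrakk>r \<in> ideal_R; s \<in> ideal_R\<rbrakk> \<Longrightarrow> r * s \<in> ideal_R" "r \<in> ideal_R \<Longrightarrow> - r \<in> ideal_R"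
  "\<lbrakk>r \<in> ideal_R; s \<in> ideal_R\<rbrakk> \<Longrightarrow> r - s \<in> ideal_R"
proof -
  show minus: "r \<in> ideal_R \<Longrightarrow> - r \<in> ideal_R"
    and add: "\<lbrakk>r \<in> ideal_R; s \<in> ideal_R\<rbrakk> \<Longrightarrow> r + s \<in> ideal_R" for r s
    using subrng_ideal_R by (simp_all add: subrng_def)
  show "\<lbrakk>r \<in> ideal_R; s \<in> ideal_R\<rbrakk> \<Longrightarrow> r - s \<in> ideal_R"
    using add[OF _ minus, of r s] by simp
qed (use subrng_ideal_R in \<open>simp_all add: subrng_def\<close>)

lemma keys_ideal_R:
  assumes "r \<in> ideal_R"
  shows "Poly_Mapping.keys r \<subseteq> - {0}"
proof -
  have keys: "Poly_Mapping.keys (s * indet i) \<subseteq> - {0}" for s :: poly_S and i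
  proof
    fix k assume "k \<in> Poly_Mapping.keys (s * indet i)"
    then obtain l where "k = l + Poly_Mapping.single i 1"
      using keys_mult[of s "indet i"] by (auto simp: indet_def)
    then have "Poly_Mapping.lookup k i \<noteq> 0"
      by (simp add: lookup_add lookup_single)
    then show "k \<in> - {0}"
      by auto
  qed
  obtain a b c d where "r = a * indet X + b * indet Y + c * indet U + d * indet V"
    using assms unfolding ideal_R_def by blast
  then show ?thesis
    using keys keys_add by (smt (verit, best) Un_iff subset_iff)
qed

text \<open>
  As a ring without unity, \<open>ideal_R\<close> is generated by the four indeterminates. Additively it
  is generated by the monomials of positive degree, and each of these is a nonempty product of
  indeterminates. Identities of scalar actions therefore only need to be checked
  on indeterminates.
\<close>

lemma ideal_R_induct [consumes 1, case_names zero indet diff mult]: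
  assumes "r \<in> ideal_R"
    and zero: "P 0"
    and indet: "\<And>i. P (indet i)"
    and diff: "\<And>r s. \<lbrakk>r \<in> ideal_R; s \<in> ideal_R; P r; P s\<rbrakk> \<Longrightarrow> P (r - s)"
    and mult: "\<And>r s. \<lbrakk>r \<in> ideal_R; s \<in> ideal_R; P r; P s\<rbrakk> \<Longrightarrow> P (r * s)"
  shows "P r"
proof -
  have "r \<in> ideal_R \<and> P r"
    using keys_ideal_R[OF assms(1)]
  proof (induction r rule: frag_induction)
    case (one k)
    then have "k \<noteq> 0"
      by simp
    then show ?case
    proof (induction k rule: exponent_induct)
      case (single i)
      then show ?case
        using indet indet_in_ideal_R by (simp add: frag_of_single)
    next
      case (add_single k i)
      then show ?case
        using mult indet indet_in_ideal_R mult_indet_in_ideal_R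
        unfolding frag_of_mult_indet[symmetric] by blast
    qed
  qed (use zero diff ideal_R_closed in auto)
  then show ?thesis
    by simp
qed

section \<open>Commuting central endomorphisms make a group a module\<close>

text \<open>
  The order in which the four powers are composed is an arbitrary choice; it is immaterial for
  the commuting maps to which this is applied.
\<close>

definition monomial_action :: "(indeterminate \<Rightarrow> 'a \<Rightarrow> 'a) \<Rightarrow> (indeterminate \<Rightarrow>\<^sub>0 nat) \<Rightarrow> 'a \<Rightarrow> 'a"
  where "monomial_action p k x =
    (p X ^^ Poly_Mapping.lookup k X) ((p Y ^^ Poly_Mapping.lookup k Y)
      ((p U ^^ Poly_Mapping.lookup k U) ((p V ^^ Poly_Mapping.lookup k V) x)))"

locale commuting_central_endomorphisms = group G for G :: "('a, 'm) monoid_scheme" (structure) +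
  fixes p :: "indeterminate \<Rightarrow> 'a \<Rightarrow> 'a"
  assumes hom: "p i \<in> hom G G"
    and central: "x \<in> carrier G \<Longrightarrow> p i x \<in> group_center G"
    and commute: "x \<in> carrier G \<Longrightarrow> p i (p j x) = p j (p i x)"
begin

lemma p_closed: "x \<in> carrier G \<Longrightarrow> p i x \<in> carrier G"
  using central by (rule center_carrier)

lemma funpow_closed: "x \<in> carrier G \<Longrightarrow> (p i ^^ n) x \<in> carrier G"
  by (induction n) (simp_all add: p_closed)

lemma funpow_commute: "x \<in> carrier G \<Longrightarrow> p i ((p j ^^ n) x) = (p j ^^ n) (p i x)"
  by (induction n) (simp_all add: commute[of _ i j] funpow_closed)

lemma monomial_action_zero: "monomial_action p 0 x = x"
  by (simp add: monomial_action_def)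

lemma monomial_action_add_single:
  assumes "x \<in> carrier G"
  shows "monomial_action p (k + Poly_Mapping.single i 1) x = p i (monomial_action p k x)"
  using assms
  by (cases i) (simp_all add: monomial_action_def lookup_add lookup_single funpow_closed
      funpow_commute p_closed)

lemma monomial_action_single:
  "x \<in> carrier G \<Longrightarrow> monomial_action p (Poly_Mapping.single i 1) x = p i x"
  using monomial_action_add_single[of x 0 i] by (simp add: monomial_action_zero)

lemma monomial_action_central:
  assumes "k \<noteq> 0" "x \<in> carrier G"
  shows "monomial_action p k x \<in> group_center G"
  using assms(1)
proof (induction k rule: exponent_induct)
  case (add_single k i)
  then show ?case
    using assms(2) by (simp only: monomial_action_add_single central center_carrier)
qed (use assms(2) in \<open>simp only: monomial_action_single central\<close>)

lemma monomial_action_mult: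
  assumes "k \<noteq> 0" "x \<in> carrier G" "y \<in> carrier G"
  shows "monomial_action p k (x \<otimes> y) = monomial_action p k x \<otimes> monomial_action p k y"
  using assms(1)
proof (induction k rule: exponent_induct)
  case (add_single k i)
  then show ?case
    using assms hom[of i] center_carrier monomial_action_central[OF \<open>k \<noteq> 0\<close>]
    by (simp only: monomial_action_add_single hom_mult m_closed)
qed (use assms(2-3) hom in \<open>simp only: monomial_action_single hom_mult m_closed\<close>)

text \<open>
  The additive group of polynomials without constant term is free abelian on the monomials of
  positive degree, and at a fixed \<open>x\<close> these monomials take values in the center, which is an
  abelian group. The universal property thus extends \<open>k \<mapsto> monomial_action p k x\<close> to an
  additive map on \<open>ideal_R\<close>. The constant monomial has to stay out: it acts as the identity, whose
  values need not be central. This is why the scalar ring has no unity.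
\<close>

lemma polynomial_action:
  obtains act where
    "\<And>x r. \<lbrakk>x \<in> carrier G; r \<in> ideal_R\<rbrakk> \<Longrightarrow> act r x \<in> group_center G"
    "\<And>x i. x \<in> carrier G \<Longrightarrow> act (indet i) x = p i x"
    "\<And>x r s. \<lbrakk>x \<in> carrier G; r \<in> ideal_R; s \<in> ideal_R\<rbrakk> \<Longrightarrow> act (r + s) x = act r x \<otimes> act s x"
    "\<And>x y r. \<lbrakk>x \<in> carrier G; y \<in> carrier G; r \<in> ideal_R\<rbrakk>
      \<Longrightarrow> act r (x \<otimes> y) = act r x \<otimes> act r y"
    "\<And>x r s. \<lbrakk>x \<in> carrier G; r \<in> ideal_R; s \<in> ideal_R\<rbrakk> \<Longrightarrow> act r (act s x) = act (r * s) x"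
proof -
  let ?Z = "G\<lparr>carrier := group_center G\<rparr>"
  let ?F = "free_Abelian_group (- {0 :: indeterminate \<Rightarrow>\<^sub>0 nat})"
  interpret Z: comm_group ?Z
    by (rule comm_group_center)
  have "\<exists>h. h \<in> hom ?F ?Z \<and> (\<forall>k. k \<noteq> 0 \<longrightarrow> h (frag_of k) = monomial_action p k x)"
    if x: "x \<in> carrier G" for x
  proof -
    have "(\<lambda>k. monomial_action p k x) ` (- {0}) \<subseteq> carrier ?Z"
      using x monomial_action_central by auto
    then obtain h where "h \<in> hom ?F ?Z"
      "\<And>k. k \<in> - {0} \<Longrightarrow> h (frag_of k) = monomial_action p k x"
      by (rule Z.free_Abelian_group_universal) blast
    then show ?thesis
      by auto
  qed
  then obtain H where H: "\<And>x. x \<in> carrier G \<Longrightarrow> H x \<in> hom ?F ?Z"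
    and H_frag: "\<And>x k. \<lbrakk>x \<in> carrier G; k \<noteq> 0\<rbrakk> \<Longrightarrow> H x (frag_of k) = monomial_action p k x"
    by metis
  define K where "K = {r :: poly_S. Poly_Mapping.keys r \<subseteq> - {0}}"
  have K: "carrier ?F = K"
    by (simp add: K_def free_Abelian_group_def)
  have R_K: "ideal_R \<subseteq> K"
    using keys_ideal_R by (auto simp: K_def)
  have H_central: "H x r \<in> group_center G" if "x \<in> carrier G" "r \<in> K" for x r
    using hom_in_carrier[OF H[OF that(1)], of r] that(2) by (simp add: K)
  have H_closed: "H x r \<in> carrier G" if "x \<in> carrier G" "r \<in> K" for x r
    using H_central[OF that] by (rule center_carrier)
  have H_add: "H x (r + s) = H x r \<otimes> H x s" if "x \<in> carrier G" "r \<in> K" "s \<in> K" for x r s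
    using hom_mult[OF H[OF that(1)], of r s] that(2-3) by (simp add: K)
  have K_diff: "r - s \<in> K" if "r \<in> K" "s \<in> K" for r s
    using that keys_diff[of r s] by (auto simp: K_def)
  have H_diff: "H x (r - s) = H x r \<otimes> inv (H x s)" if "x \<in> carrier G" "r \<in> K" "s \<in> K" for x r s
  proof -
    have "H x r = H x (r - s) \<otimes> H x s"
      using H_add[OF that(1) K_diff[OF that(2,3)] that(3)] by simp
    then show ?thesis
      using that by (simp add: m_assoc H_closed K_diff)
  qed
  have H_zero: "H x 0 = \<one>" if "x \<in> carrier G" for x
    using H_diff[OF that, of 0 0] H_closed[OF that, of 0] by (simp add: K_def)
  have H_indet: "H x (indet i) = p i x" if "x \<in> carrier G" for x i
  proof -
    have "Poly_Mapping.single i (1 :: nat) \<noteq> 0"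
      by (metis lookup_single_eq lookup_zero one_neq_zero)
    then show ?thesis
      using that H_frag[OF that, of "Poly_Mapping.single i 1"] monomial_action_single[OF that, of i]
      by (simp add: frag_of_single)
  qed
  \<comment> \<open>Additivity in the group argument passes to differences of scalars because the values are central.\<close>
  have H_mult: "r \<in> K \<and> H (x \<otimes> y) r = H x r \<otimes> H y r"
    if x: "x \<in> carrier G" and y: "y \<in> carrier G" and r: "Poly_Mapping.keys r \<subseteq> - {0}" for x y r
    using r
  proof (induction r rule: frag_induction)
    case zero
    show ?case
      using x y by (simp add: H_zero K_def)
  next
    case (one k)
    then show ?case
      using x y by (simp add: H_frag monomial_action_mult K_def)
  next
    case (diff r s)
    then have *: "r \<in> K" "s \<in> K" and IH: "H (x \<otimes> y) r = H x r \<otimes> H y r"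
        "H (x \<otimes> y) s = H x s \<otimes> H y s"
      by auto
    have "H x r \<otimes> H y r \<otimes> inv (H x s \<otimes> H y s) = H x r \<otimes> (H y r \<otimes> (inv (H y s) \<otimes> inv (H x s)))"
      using x y * by (simp add: m_assoc inv_mult_group H_closed)
    also have "\<dots> = H x r \<otimes> (inv (H x s) \<otimes> (H y r \<otimes> inv (H y s)))"
      using x y * center_comm[OF center_inv[OF H_central[OF x \<open>s \<in> K\<close>]], of "H y r \<otimes> inv (H y s)"]
      by (simp add: m_assoc H_closed)
    finally show ?case
      using x y * by (simp add: IH H_diff K_diff m_assoc H_closed)
  qed
  have mult_diff: "p i (x \<otimes> inv y) = p i x \<otimes> inv (p i y)"
    if "x \<in> carrier G" "y \<in> carrier G" for x y i
    using that hom[of i] by (simp add: hom_mult hom_self_inv)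
  \<comment> \<open>The case of an indeterminate on the left in the associativity law \<open>H_scale\<close> below.\<close>
  have p_H: "r \<in> K \<and> indet i * r \<in> K \<and> p i (H x r) = H x (indet i * r)"
    if x: "x \<in> carrier G" and r: "Poly_Mapping.keys r \<subseteq> - {0}" for x i r
    using r
  proof (induction r rule: frag_induction)
    case zero
    show ?case
      using x hom_self_one[OF hom] by (simp add: H_zero K_def)
  next
    case (one k)
    have eq: "indet i * frag_of k = frag_of (k + Poly_Mapping.single i 1)"
      by (simp only: mult.commute[of "indet i"] frag_of_mult_indet)
    have "Poly_Mapping.lookup (k + Poly_Mapping.single i 1) i \<noteq> 0"
      by (simp add: lookup_add)
    then have "k + Poly_Mapping.single i 1 \<noteq> 0"
      by (metis lookup_zero)
    then show ?case
      using one x monomial_action_add_single[OF x, of k i]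
      unfolding eq by (simp add: H_frag K_def)
  next
    case (diff r s)
    then show ?case
      using x by (simp add: K_diff H_diff mult_diff H_closed right_diff_distrib)
  qed
  have H_scale: "H (H x s) r = H x (r * s)" if "r \<in> ideal_R" "x \<in> carrier G" "s \<in> ideal_R" for x r s
    using that
  proof (induction r arbitrary: x s rule: ideal_R_induct)
    case zero
    then show ?case
      using R_K by (simp add: H_zero H_closed subset_iff)
  next
    case (indet i)
    then show ?case
      using p_H[OF _ keys_ideal_R] R_K by (simp add: H_indet H_closed subset_iff)
  next
    case (diff q r)
    then show ?case
      using R_K ideal_R_closed by (simp add: H_diff H_closed subset_iff left_diff_distrib)
  next
    case (mult q r)
    have "H x s \<in> carrier G"
      using mult R_K by (simp add: H_closed subset_iff)
    then have "H (H x s) (q * r) = H (H (H x s) r) q"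
      using mult.IH(1)[of "H x s" r] mult by metis
    also have "\<dots> = H (H x (r * s)) q"
      using mult by simp
    also have "\<dots> = H x (q * (r * s))"
      using mult ideal_R_closed by simp
    finally show ?case
      by (simp add: mult.assoc)
  qed
  show ?thesis
  proof
    fix x i
    show "\<lbrakk>x \<in> carrier G; r \<in> ideal_R\<rbrakk> \<Longrightarrow> H x r \<in> group_center G" for r
      using H_central R_K by blast
    show "x \<in> carrier G \<Longrightarrow> H x (indet i) = p i x"
      by (rule H_indet)
    show "\<lbrakk>x \<in> carrier G; r \<in> ideal_R; s \<in> ideal_R\<rbrakk> \<Longrightarrow> H x (r + s) = H x r \<otimes> H x s" for r s
      using H_add R_K by blast
    show "\<lbrakk>x \<in> carrier G; y \<in> carrier G; r \<in> ideal_R\<rbrakk> \<Longrightarrow> H (x \<otimes> y) r = H x r \<otimes> H y r" for y r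
      using H_mult keys_ideal_R by blast
    show "\<lbrakk>x \<in> carrier G; r \<in> ideal_R; s \<in> ideal_R\<rbrakk> \<Longrightarrow> H (H x s) r = H x (r * s)" for r s
      using H_scale by simp
  qed
qed

end

section \<open>Modules and pairs of commuting central automorphisms\<close>

locale central_automorphism_pair = group G for G :: "('a, 'm) monoid_scheme" (structure) +
  fixes f g :: "'a \<Rightarrow> 'a"
  assumes f: "central_automorphism G f"
    and g: "central_automorphism G g"
    and fg: "x \<in> carrier G \<Longrightarrow> f (g x) = g (f x)"

lemma commute_inverse:
  assumes bij: "bij_betw h A A" and k: "\<And>x. x \<in> A \<Longrightarrow> k x \<in> A"
    and comm: "\<And>x. x \<in> A \<Longrightarrow> h (k x) = k (h x)" and x: "x \<in> A"
  shows "inv_into A h (k x) = k (inv_into A h x)"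
proof -
  have y: "inv_into A h x \<in> A" "h (inv_into A h x) = x"
    using bij x by (auto simp: bij_betw_def inv_into_into f_inv_into_f)
  have "inv_into A h (h (k (inv_into A h x))) = k (inv_into A h x)"
    using bij k y by (simp add: bij_betw_def inv_into_f_f)
  then show ?thesis
    using y comm by simp
qed

text \<open>
  The indeterminates act as the displacements of \<open>f\<close>, \<open>g\<close> and their inverses, in the order
  \<open>X, Y, U, V\<close>. All four automorphisms commute because \<open>f\<close> and \<open>g\<close> do.
\<close>

lemma (in central_automorphism_pair) ex_module:
  obtains M :: "'a R_module" where "M \<in> M_class" "carrier M = carrier G" "one M = \<one>"
    "\<And>x y. \<lbrakk>x \<in> carrier G; y \<in> carrier G\<rbrakk> \<Longrightarrow> x \<otimes>\<^bsub>M\<^esub> y = x \<otimes> y"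
    "\<And>x. x \<in> carrier G \<Longrightarrow> x \<otimes> indet X \<bullet>\<^bsub>M\<^esub> x = f x"
    "\<And>x. x \<in> carrier G \<Longrightarrow> x \<otimes> indet Y \<bullet>\<^bsub>M\<^esub> x = g x"
proof -
  define f' where "f' = inv_into (carrier G) f"
  define g' where "g' = inv_into (carrier G) g"
  have f': "central_automorphism G f'" and g': "central_automorphism G g'"
    unfolding f'_def g'_def using f g by (simp_all add: inverse_central_automorphism)
  have ff': "f (f' x) = x" "f' (f x) = x" and gg': "g (g' x) = x" "g' (g x) = x"
    if "x \<in> carrier G" for x
    using that central_automorphism_bij[OF f] central_automorphism_bij[OF g]
    by (auto simp: f'_def g'_def bij_betw_def f_inv_into_f)
  have gf: "g (f x) = f (g x)" if "x \<in> carrier G" for x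
    using fg[OF that] by simp
  have gf': "g (f' x) = f' (g x)" if "x \<in> carrier G" for x
    unfolding f'_def using that commute_inverse[of f "carrier G" g]
      central_automorphism_bij[OF f] central_automorphism_closed[OF g] fg by simp
  have fg': "f (g' x) = g' (f x)" if "x \<in> carrier G" for x
    unfolding g'_def using that commute_inverse[of g "carrier G" f]
      central_automorphism_bij[OF g] central_automorphism_closed[OF f] gf by simp
  have f'g': "f' (g' x) = g' (f' x)" if "x \<in> carrier G" for x
    unfolding g'_def using that commute_inverse[of g "carrier G" f']
      central_automorphism_bij[OF g] central_automorphism_closed[OF f'] gf' by simp
  define h where "h i = (case i of X \<Rightarrow> f | Y \<Rightarrow> g | U \<Rightarrow> f' | V \<Rightarrow> g')" for i
  have h: "central_automorphism G (h i)" for i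
    using f g f' g' by (cases i) (simp_all add: h_def)
  have h_comm: "h i (h j x) = h j (h i x)" if "x \<in> carrier G" for i j x
    using that by (cases i; cases j) (simp_all add: h_def ff' gg' fg gf' fg' f'g')
  interpret commuting_central_endomorphisms G "\<lambda>i. displacement G (h i)"
    by unfold_locales
      (simp_all add: displacement_hom displacement_central displacement_commute h h_comm)
  obtain act where act:
    "\<And>x r. \<lbrakk>x \<in> carrier G; r \<in> ideal_R\<rbrakk> \<Longrightarrow> act r x \<in> group_center G"
    "\<And>x i. x \<in> carrier G \<Longrightarrow> act (indet i) x = displacement G (h i) x"
    "\<And>x r s. \<lbrakk>x \<in> carrier G; r \<in> ideal_R; s \<in> ideal_R\<rbrakk> \<Longrightarrow> act (r + s) x = act r x \<otimes> act s x"
    "\<And>x y r. \<lbrakk>x \<in> carrier G; y \<in> carrier G; r \<in> ideal_R\<rbrakk>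
      \<Longrightarrow> act r (x \<otimes> y) = act r x \<otimes> act r y"
    "\<And>x r s. \<lbrakk>x \<in> carrier G; r \<in> ideal_R; s \<in> ideal_R\<rbrakk> \<Longrightarrow> act r (act s x) = act (r * s) x"
    using polynomial_action by blast
  have act_closed: "act r x \<in> carrier G" if "x \<in> carrier G" "r \<in> ideal_R" for r x
    using act(1)[OF that] by (rule center_carrier)
  define M :: "'a R_module" where "M =
    \<lparr>carrier = carrier G,
     monoid.mult = (\<lambda>x y. if x \<in> carrier G \<and> y \<in> carrier G then x \<otimes> y else undefined),
     one = \<one>,
     scale = (\<lambda>r x. if r \<in> ideal_R \<and> x \<in> carrier G then act r x else undefined)\<rparr>"
  have M: "carrier M = carrier G" "one M = \<one>"
    "\<And>x y. \<lbrakk>x \<in> carrier G; y \<in> carrier G\<rbrakk> \<Longrightarrow> x \<otimes>\<^bsub>M\<^esub> y = x \<otimes> y"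
    "\<And>r x. \<lbrakk>r \<in> ideal_R; x \<in> carrier G\<rbrakk> \<Longrightarrow> r \<bullet>\<^bsub>M\<^esub> x = act r x"
    by (simp_all add: M_def)
  have "group M"
  proof (rule groupI)
    fix x assume "x \<in> carrier M"
    then show "\<exists>y\<in>carrier M. y \<otimes>\<^bsub>M\<^esub> x = \<one>\<^bsub>M\<^esub>"
      by (intro bexI[of _ "inv x"]) (simp_all add: M)
  qed (simp_all add: M m_assoc)
  have "group_center M = group_center G"
    by (auto simp: group_center_def M)
  then have module: "central_generalized_module ideal_R M"
    using \<open>group M\<close> subrng_ideal_R
    by (intro central_generalized_module.intro central_generalized_module_axioms.intro)
      (auto simp: M act_closed act ideal_R_closed, auto simp: M_def)
  have ann: "indet i + indet j + indet i * indet j \<in> annihilator ideal_R M"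
    if inverse: "\<And>x. x \<in> carrier G \<Longrightarrow> h i (h j x) = x" for i j
  proof -
    have "act (indet i + indet j + indet i * indet j) x = \<one>" if x: "x \<in> carrier G" for x
    proof -
      have "act (indet i + indet j + indet i * indet j) x
        = act (indet i) x \<otimes> act (indet j) x \<otimes> act (indet i) (act (indet j) x)"
        using x by (simp add: act(3,5) ideal_R_closed indet_in_ideal_R)
      also have "\<dots> = \<one>"
        using x displacement_inverse_relation[OF h h inverse x] act_closed indet_in_ideal_R
        by (simp add: act(2) p_closed)
      finally show ?thesis .
    qed
    then show ?thesis
      by (simp add: annihilator_def M ideal_R_closed indet_in_ideal_R)
  qed
  have "M \<in> M_class"
    using module ann[of X U] ann[of Y V] by (simp add: M_class_def h_def ff' gg')
  moreover have "x \<otimes> indet X \<bullet>\<^bsub>M\<^esub> x = f x" "x \<otimes> indet Y \<bullet>\<^bsub>M\<^esub> x = g x" if "x \<in> carrier G" for x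
    using that f g by (simp_all add: M indet_in_ideal_R act(2) h_def m_displacement)
  ultimately show ?thesis
    using that M by blast
qed

text \<open>
  The action of \<open>1 + i\<close>. The polynomial itself is not a scalar, but on modules in \<open>M_class\<close> it
  acts as a central automorphism.
\<close>

definition one_plus :: "'a R_module \<Rightarrow> indeterminate \<Rightarrow> 'a \<Rightarrow> 'a"
  where "one_plus G i x = x \<otimes>\<^bsub>G\<^esub> indet i \<bullet>\<^bsub>G\<^esub> x"

context central_generalized_module
begin

lemma scale_closed: "\<lbrakk>r \<in> R; x \<in> carrier G\<rbrakk> \<Longrightarrow> r \<bullet> x \<in> carrier G"
  using scale_central by (rule center_carrier)

lemma zero_scale: "x \<in> carrier G \<Longrightarrow> 0 \<bullet> x = \<one>"
  using scale_add_left[of 0 0 x] scalar_ring scale_closed[of 0 x] by (simp add: subrng_def)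

lemma diff_scale:
  assumes "r \<in> R" "s \<in> R" "x \<in> carrier G"
  shows "(r - s) \<bullet> x = r \<bullet> x \<otimes> inv (s \<bullet> x)"
proof -
  have "r + - s \<in> R"
    using assms scalar_ring unfolding subrng_def by blast
  then have d: "r - s \<in> R"
    by simp
  have "r \<bullet> x = (r - s) \<bullet> x \<otimes> s \<bullet> x"
    using scale_add_left[OF d assms(2,3)] by simp
  then show ?thesis
    using assms d by (simp add: m_assoc scale_closed)
qed

end

locale M_class_module =
  fixes G :: "'a R_module" (structure)
  assumes M_class: "G \<in> M_class"

sublocale M_class_module \<subseteq> central_generalized_module ideal_R G
  using M_class by (simp add: M_class_def)

context M_class_module
begin

text \<open>
  The annihilator condition says \<open>(1 + X) (1 + U) = 1\<close> and \<open>(1 + Y) (1 + V) = 1\<close>.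
\<close>

lemma one_plus_inverse:
  assumes "(i, j) \<in> {(X, U), (U, X), (Y, V), (V, Y)}" and x: "x \<in> carrier G"
  shows "one_plus G i (one_plus G j x) = x"
proof -
  have ann: "indet i + indet j + indet i * indet j \<in> annihilator ideal_R G"
    using assms(1) M_class by (auto simp: M_class_def add.commute mult.commute)
  have "indet i \<bullet> x \<otimes> indet j \<bullet> x \<otimes> indet i \<bullet> indet j \<bullet> x
    = (indet i + indet j + indet i * indet j) \<bullet> x"
    using x by (simp add: scale_add_left scale_scale ideal_R_closed indet_in_ideal_R)
  also have "\<dots> = \<one>"
    using ann x by (simp add: annihilator_def)
  finally have sum: "indet i \<bullet> x \<otimes> (indet j \<bullet> x \<otimes> indet i \<bullet> indet j \<bullet> x) = \<one>"
    using x by (simp add: m_assoc scale_closed indet_in_ideal_R)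
  have "one_plus G i (one_plus G j x)
    = x \<otimes> (indet j \<bullet> x \<otimes> (indet i \<bullet> x \<otimes> indet i \<bullet> indet j \<bullet> x))"
    using x by (simp add: one_plus_def scale_add_right m_assoc scale_closed indet_in_ideal_R)
  also have "\<dots> = x"
    using x sum center_lcomm[OF scale_central, of "indet i" x "indet j \<bullet> x"]
    by (simp add: scale_closed indet_in_ideal_R)
  finally show ?thesis .
qed

lemma one_plus_closed: "x \<in> carrier G \<Longrightarrow> one_plus G i x \<in> carrier G"
  by (simp add: one_plus_def scale_closed indet_in_ideal_R)

lemma one_plus_hom: "one_plus G i \<in> hom G G"
proof (rule homI)
  fix x y assume x: "x \<in> carrier G" and y: "y \<in> carrier G"
  then show "one_plus G i (x \<otimes> y) = one_plus G i x \<otimes> one_plus G i y"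
    using center_lcomm[OF scale_central, of "indet i" x y "indet i \<bullet> y"]
    by (simp add: one_plus_def scale_add_right m_assoc scale_closed indet_in_ideal_R)
qed (rule one_plus_closed)

lemma one_plus_central_automorphism: "central_automorphism G (one_plus G i)"
proof -
  obtain j where j: "(i, j) \<in> {(X, U), (U, X), (Y, V), (V, Y)}"
    "(j, i) \<in> {(X, U), (U, X), (Y, V), (V, Y)}"
    by (cases i) auto
  have "bij_betw (one_plus G i) (carrier G) (carrier G)"
    using one_plus_inverse[OF j(1)] one_plus_inverse[OF j(2)] one_plus_closed
    by (intro bij_betw_byWitness[where f' = "one_plus G j"]) auto
  moreover have "displacement G (one_plus G i) x \<in> group_center G" if "x \<in> carrier G" for x
    using that by (simp add: displacement_def one_plus_def scale_closed scale_central indet_in_ideal_R)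
  ultimately show ?thesis
    using one_plus_hom by (simp add: central_automorphism_def iso_def)
qed

lemma one_plus_commute:
  assumes x: "x \<in> carrier G"
  shows "one_plus G i (one_plus G j x) = one_plus G j (one_plus G i x)"
proof -
  have *: "one_plus G i (one_plus G j x)
    = x \<otimes> (indet j \<bullet> x \<otimes> (indet i \<bullet> x \<otimes> (indet i * indet j) \<bullet> x))" for i j
    using x by (simp add: one_plus_def scale_add_right m_assoc scale_closed scale_scale
        ideal_R_closed indet_in_ideal_R)
  show ?thesis
    unfolding *
    using x center_lcomm[OF scale_central, of "indet i" x "indet j \<bullet> x"]
    by (simp add: scale_closed indet_in_ideal_R ideal_R_closed mult.commute)
qed

sublocale central_automorphism_pair G "one_plus G X" "one_plus G Y"
  by unfold_locales (simp_all add: one_plus_central_automorphism one_plus_commute)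

end

section \<open>The F-quasigroup of a pair of commuting central automorphisms\<close>

lemma (in quasigroup) op_closed: "\<lbrakk>x \<in> carrier Q; y \<in> carrier Q\<rbrakk> \<Longrightarrow> x \<cdot> y \<in> carrier Q"
  using left_translation by (auto simp: bij_betw_def)

lemma (in quasigroup) local_right_unit:
  assumes x: "x \<in> carrier Q"
  shows "\<alpha> x \<in> carrier Q" "x \<cdot> \<alpha> x = x"
proof -
  have inj: "inj_on (\<lambda>y. x \<cdot> y) (carrier Q)" and im: "(\<lambda>y. x \<cdot> y) ` carrier Q = carrier Q"
    using left_translation[OF x] by (auto simp: bij_betw_def)
  have "\<exists>z. z \<in> carrier Q \<and> x \<cdot> z = x"
    using x im by (metis imageE)
  then have "\<exists>!z. z \<in> carrier Q \<and> x \<cdot> z = x"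
    using inj unfolding inj_on_def by (elim exE) (rule ex1I, auto)
  then have "\<alpha> x \<in> carrier Q \<and> x \<cdot> \<alpha> x = x"
    unfolding local_right_unit_def by (rule theI')
  then show "\<alpha> x \<in> carrier Q" "x \<cdot> \<alpha> x = x"
    by simp_all
qed

lemma (in quasigroup) local_left_unit:
  assumes x: "x \<in> carrier Q"
  shows "\<beta> x \<in> carrier Q" "\<beta> x \<cdot> x = x"
proof -
  have inj: "inj_on (\<lambda>y. y \<cdot> x) (carrier Q)" and im: "(\<lambda>y. y \<cdot> x) ` carrier Q = carrier Q"
    using right_translation[OF x] by (auto simp: bij_betw_def)
  have "\<exists>z. z \<in> carrier Q \<and> z \<cdot> x = x"
    using x im by (metis imageE)
  then have "\<exists>!z. z \<in> carrier Q \<and> z \<cdot> x = x"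
    using inj unfolding inj_on_def by (elim exE) (rule ex1I, auto)
  then have "\<beta> x \<in> carrier Q \<and> \<beta> x \<cdot> x = x"
    unfolding local_left_unit_def by (rule theI')
  then show "\<beta> x \<in> carrier Q" "\<beta> x \<cdot> x = x"
    by simp_all
qed

context group
begin

lemma left_mult_bij: "a \<in> carrier G \<Longrightarrow> bij_betw (\<lambda>x. a \<otimes> x) (carrier G) (carrier G)"
  by (rule bij_betw_byWitness[where f' = "\<lambda>x. inv a \<otimes> x"]) auto

lemma right_mult_bij: "a \<in> carrier G \<Longrightarrow> bij_betw (\<lambda>x. x \<otimes> a) (carrier G) (carrier G)"
  by (rule bij_betw_byWitness[where f' = "\<lambda>x. x \<otimes> inv a"]) (auto simp: m_assoc)

end

definition affine_quasigroup ::
    "('a, 'm) monoid_scheme \<Rightarrow> ('a \<Rightarrow> 'a) \<Rightarrow> ('a \<Rightarrow> 'a) \<Rightarrow> 'a \<Rightarrow> 'a magma"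
  where "affine_quasigroup G f g e =
    \<lparr>carrier = carrier G,
     op = (\<lambda>x y. if x \<in> carrier G \<and> y \<in> carrier G then f x \<otimes>\<^bsub>G\<^esub> e \<otimes>\<^bsub>G\<^esub> g y else undefined)\<rparr>"

lemma carrier_affine_quasigroup [simp]: "carrier (affine_quasigroup G f g e) = carrier G"
  by (simp add: affine_quasigroup_def)

lemma op_affine_quasigroup:
  "\<lbrakk>x \<in> carrier G; y \<in> carrier G\<rbrakk>
    \<Longrightarrow> x \<cdot>\<^bsub>affine_quasigroup G f g e\<^esub> y = f x \<otimes>\<^bsub>G\<^esub> e \<otimes>\<^bsub>G\<^esub> g y"
  by (simp add: affine_quasigroup_def)

context central_automorphism_pair
begin

lemma fg_closed [simp]:
  "x \<in> carrier G \<Longrightarrow> f x \<in> carrier G" "x \<in> carrier G \<Longrightarrow> g x \<in> carrier G"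
  using f g by (simp_all add: central_automorphism_closed)

lemma fg_mult:
  "\<lbrakk>x \<in> carrier G; y \<in> carrier G\<rbrakk> \<Longrightarrow> f (x \<otimes> y) = f x \<otimes> f y"
  "\<lbrakk>x \<in> carrier G; y \<in> carrier G\<rbrakk> \<Longrightarrow> g (x \<otimes> y) = g x \<otimes> g y"
  using f g by (simp_all add: central_automorphism_mult)

lemma fg_inv:
  "x \<in> carrier G \<Longrightarrow> f (inv x) = inv (f x)"
  "x \<in> carrier G \<Longrightarrow> g (inv x) = inv (g x)"
  using f g by (simp_all add: hom_self_inv central_automorphism_hom)

lemma fg_one: "f \<one> = \<one>" "g \<one> = \<one>"
  using f g by (simp_all add: hom_self_one central_automorphism_hom)

lemma quasigroup_affine_quasigroup:
  assumes e: "e \<in> carrier G"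
  shows "quasigroup (affine_quasigroup G f g e)" (is "quasigroup ?Q")
proof
  show "carrier ?Q \<noteq> {}"
    using one_closed by auto
next
  fix a assume "a \<in> carrier ?Q"
  then have a: "a \<in> carrier G"
    by simp
  have "bij_betw ((\<lambda>x. f a \<otimes> e \<otimes> x) \<circ> g) (carrier G) (carrier G)"
    using a e by (intro bij_betw_trans[OF central_automorphism_bij[OF g]] left_mult_bij) simp
  also have "bij_betw ((\<lambda>x. f a \<otimes> e \<otimes> x) \<circ> g) (carrier G) (carrier G)
    \<longleftrightarrow> bij_betw (\<lambda>x. a \<cdot>\<^bsub>?Q\<^esub> x) (carrier ?Q) (carrier ?Q)"
    using a unfolding carrier_affine_quasigroup
    by (intro bij_betw_cong) (simp add: op_affine_quasigroup)
  finally show "bij_betw (\<lambda>x. a \<cdot>\<^bsub>?Q\<^esub> x) (carrier ?Q) (carrier ?Q)" .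
next
  fix a assume "a \<in> carrier ?Q"
  then have a: "a \<in> carrier G"
    by simp
  have "bij_betw ((\<lambda>x. x \<otimes> (e \<otimes> g a)) \<circ> f) (carrier G) (carrier G)"
    using a e by (intro bij_betw_trans[OF central_automorphism_bij[OF f]] right_mult_bij) simp
  also have "bij_betw ((\<lambda>x. x \<otimes> (e \<otimes> g a)) \<circ> f) (carrier G) (carrier G)
    \<longleftrightarrow> bij_betw (\<lambda>x. x \<cdot>\<^bsub>?Q\<^esub> a) (carrier ?Q) (carrier ?Q)"
    using a e unfolding carrier_affine_quasigroup
    by (intro bij_betw_cong) (simp add: op_affine_quasigroup m_assoc)
  finally show "bij_betw (\<lambda>x. x \<cdot>\<^bsub>?Q\<^esub> a) (carrier ?Q) (carrier ?Q)" .
qed (auto simp: affine_quasigroup_def)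

text \<open>
  For the left F-law put \<open>v = f x + e\<close>, so that \<open>f v = v + c\<close> with \<open>c\<close> central. The local unit
  \<open>u = \<alpha> x\<close> solves \<open>v + g u = x\<close>, which gives \<open>g (f u) = - c - v + f x\<close>. In the product
  \<open>(x \<cdot> y) \<cdot> (u \<cdot> z)\<close> the two occurrences of \<open>c\<close> cancel, and so does \<open>e - v + f x\<close>, which is \<open>0\<close>;
  what remains is \<open>x \<cdot> (y \<cdot> z)\<close>. The right F-law is the mirror image with
  \<open>v = e + g x\<close>.
\<close>

lemma FG_affine_quasigroup:
  assumes e: "e \<in> carrier G"
  shows "FG_quasigroup (affine_quasigroup G f g e)" (is "FG_quasigroup ?Q")
proof -
  interpret Q: quasigroup ?Q
    using e by (rule quasigroup_affine_quasigroup)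
  have "x \<cdot>\<^bsub>?Q\<^esub> (y \<cdot>\<^bsub>?Q\<^esub> z) = (x \<cdot>\<^bsub>?Q\<^esub> y) \<cdot>\<^bsub>?Q\<^esub> (\<alpha>\<^bsub>?Q\<^esub> x \<cdot>\<^bsub>?Q\<^esub> z)"
    if x: "x \<in> carrier G" and y: "y \<in> carrier G" and z: "z \<in> carrier G" for x y z
  proof -
    define u where "u = \<alpha>\<^bsub>?Q\<^esub> x"
    define v where "v = f x \<otimes> e"
    define c where "c = displacement G f v"
    have u: "u \<in> carrier G" and "v \<otimes> g u = x"
      using Q.local_right_unit[of x] x by (simp_all add: u_def v_def op_affine_quasigroup)
    have v: "v \<in> carrier G"
      using x e by (simp add: v_def)
    have c: "c \<in> group_center G"
      unfolding c_def using f v by (rule displacement_central)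
    have fv: "f v = v \<otimes> c"
      unfolding c_def using m_displacement[OF f v] by simp
    have gu: "g u = inv v \<otimes> x"
      using \<open>v \<otimes> g u = x\<close> v u by (metis fg_closed(2) inv_m_cancel(1))
    have "f (g u) = inv (f v) \<otimes> f x"
      unfolding gu using v x by (simp add: fg_mult fg_inv)
    then have gfu: "g (f u) = inv c \<otimes> (inv v \<otimes> f x)"
      using u v x c fg[of u]
      by (simp add: fv inv_mult_group m_assoc center_carrier)
    have "(x \<cdot>\<^bsub>?Q\<^esub> y) \<cdot>\<^bsub>?Q\<^esub> (u \<cdot>\<^bsub>?Q\<^esub> z) =
        f v \<otimes> (f (g y) \<otimes> (e \<otimes> (g (f u) \<otimes> (g e \<otimes> g (g z)))))"
      using x y z u e v Q.op_closed
      by (simp add: op_affine_quasigroup v_def fg_mult m_assoc)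
    also have "\<dots> = v \<otimes> (c \<otimes> (f (g y) \<otimes> (e \<otimes> (inv c \<otimes> (inv v \<otimes> f x \<otimes> (g e \<otimes> g (g z)))))))"
      using x y z u e v c by (simp add: fv gfu m_assoc center_carrier)
    also have "\<dots> = v \<otimes> (f (g y) \<otimes> (e \<otimes> (inv v \<otimes> f x \<otimes> (g e \<otimes> g (g z)))))"
      using x y z u e v c center_lcomm[OF center_inv[OF c], of "f (g y)"]
        center_lcomm[OF center_inv[OF c], of e]
      by (simp add: center_carrier)
    also have "\<dots> = x \<cdot>\<^bsub>?Q\<^esub> (y \<cdot>\<^bsub>?Q\<^esub> z)"
      using x y z u e Q.op_closed
      by (simp add: op_affine_quasigroup v_def fg_mult m_assoc inv_mult_group fg)
    finally show ?thesis
      by (simp add: u_def)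
  qed
  moreover
  have "(z \<cdot>\<^bsub>?Q\<^esub> y) \<cdot>\<^bsub>?Q\<^esub> x = (z \<cdot>\<^bsub>?Q\<^esub> \<beta>\<^bsub>?Q\<^esub> x) \<cdot>\<^bsub>?Q\<^esub> (y \<cdot>\<^bsub>?Q\<^esub> x)"
    if x: "x \<in> carrier G" and y: "y \<in> carrier G" and z: "z \<in> carrier G" for x y z
  proof -
    define u where "u = \<beta>\<^bsub>?Q\<^esub> x"
    define v where "v = e \<otimes> g x"
    define c where "c = displacement G g v"
    have u: "u \<in> carrier G" and "f u \<otimes> v = x"
      using Q.local_left_unit[of x] x e
      by (simp_all add: u_def v_def op_affine_quasigroup m_assoc)
    have v: "v \<in> carrier G"
      using x e by (simp add: v_def)
    have c: "c \<in> group_center G"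
      unfolding c_def using g v by (rule displacement_central)
    have gv: "g v = v \<otimes> c"
      unfolding c_def using m_displacement[OF g v] by simp
    have fu: "f u = x \<otimes> inv v"
      using \<open>f u \<otimes> v = x\<close> v u x by (simp add: inv_solve_right)
    have "g (f u) = g x \<otimes> inv (g v)"
      unfolding fu using v x by (simp add: fg_mult fg_inv)
    then have fgu: "f (g u) = g x \<otimes> (inv c \<otimes> inv v)"
      using u v x c fg[of u]
      by (simp add: gv inv_mult_group m_assoc center_carrier)
    have "(z \<cdot>\<^bsub>?Q\<^esub> u) \<cdot>\<^bsub>?Q\<^esub> (y \<cdot>\<^bsub>?Q\<^esub> x) =
        f (f z) \<otimes> (f e \<otimes> (f (g u) \<otimes> (e \<otimes> (g (f y) \<otimes> g v))))"
      using x y z u e v Q.op_closed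
      by (simp add: op_affine_quasigroup v_def fg_mult m_assoc)
    also have "\<dots> = f (f z) \<otimes> (f e \<otimes> (g x \<otimes> (inv c \<otimes> (inv v \<otimes> (e \<otimes> (f (g y) \<otimes> (v \<otimes> c)))))))"
      using x y z u e v c by (simp add: gv fgu m_assoc center_carrier fg)
    also have "\<dots> = f (f z) \<otimes> (f e \<otimes> (g x \<otimes> (inv v \<otimes> (e \<otimes> (f (g y) \<otimes> v)))))"
      using x y z u e v c center_comm[OF c, of "inv v \<otimes> (e \<otimes> (f (g y) \<otimes> v))"]
      by (simp add: center_carrier m_assoc)
    also have "\<dots> = (z \<cdot>\<^bsub>?Q\<^esub> y) \<cdot>\<^bsub>?Q\<^esub> x"
      using x y z u e Q.op_closed
      by (simp add: op_affine_quasigroup v_def fg_mult m_assoc inv_mult_group)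
    finally show ?thesis
      by (simp add: u_def)
  qed
  moreover have "\<exists>H :: 'a monoid. group H \<and> isotopic ?Q H"
  proof -
    define H :: "'a monoid" where "H = \<lparr>carrier = carrier G, monoid.mult = (\<otimes>), one = \<one>\<rparr>"
    have "group H"
    proof (rule groupI)
      fix x assume "x \<in> carrier H"
      then show "\<exists>y\<in>carrier H. y \<otimes>\<^bsub>H\<^esub> x = \<one>\<^bsub>H\<^esub>"
        by (intro bexI[of _ "inv x"]) (simp_all add: H_def)
    qed (simp_all add: H_def m_assoc)
    moreover have "bij_betw ((\<lambda>x. x \<otimes> e) \<circ> f) (carrier G) (carrier G)"
      using e by (intro bij_betw_trans[OF central_automorphism_bij[OF f]] right_mult_bij)
    then have "isotopic ?Q H"
      unfolding isotopic_def
      by (intro exI[of _ "(\<lambda>x. x \<otimes> e) \<circ> f"] exI[of _ g] exI[of _ id])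
        (simp add: H_def op_affine_quasigroup central_automorphism_bij[OF g])
    ultimately show ?thesis
      by blast
  qed
  ultimately show ?thesis
    by unfold_locales simp_all
qed

text \<open>
  The two products in the definition of \<open>M_set\<close> are the same word except that one contains
  \<open>e + f (g y)\<close> where the other contains \<open>f (g y) + e\<close>, and \<open>f (g y)\<close> runs through the whole group.
\<close>

lemma M_set_affine_quasigroup:
  assumes e: "e \<in> carrier G"
  shows "\<one> \<in> M_set (affine_quasigroup G f g e) \<longleftrightarrow> e \<in> group_center G"
    (is "_ \<in> M_set ?Q \<longleftrightarrow> _")
proof -
  interpret Q: quasigroup ?Q
    using e by (rule quasigroup_affine_quasigroup)
  have "(x \<cdot>\<^bsub>?Q\<^esub> \<one>) \<cdot>\<^bsub>?Q\<^esub> (y \<cdot>\<^bsub>?Q\<^esub> x) = (x \<cdot>\<^bsub>?Q\<^esub> y) \<cdot>\<^bsub>?Q\<^esub> (\<one> \<cdot>\<^bsub>?Q\<^esub> x)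
      \<longleftrightarrow> e \<otimes> f (g y) = f (g y) \<otimes> e"
    if x: "x \<in> carrier G" and y: "y \<in> carrier G" for x y
  proof -
    have "(x \<cdot>\<^bsub>?Q\<^esub> \<one>) \<cdot>\<^bsub>?Q\<^esub> (y \<cdot>\<^bsub>?Q\<^esub> x)
        = f (f x) \<otimes> (f e \<otimes> ((e \<otimes> f (g y)) \<otimes> (g e \<otimes> g (g x))))"
      using x y e Q.op_closed by (simp add: op_affine_quasigroup fg_mult fg_one fg m_assoc)
    moreover have "(x \<cdot>\<^bsub>?Q\<^esub> y) \<cdot>\<^bsub>?Q\<^esub> (\<one> \<cdot>\<^bsub>?Q\<^esub> x)
        = f (f x) \<otimes> (f e \<otimes> ((f (g y) \<otimes> e) \<otimes> (g e \<otimes> g (g x))))"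
      using x y e Q.op_closed by (simp add: op_affine_quasigroup fg_mult fg_one m_assoc)
    ultimately show ?thesis
      using x y e by (simp del: m_assoc)
  qed
  then have "\<one> \<in> M_set ?Q \<longleftrightarrow> (\<forall>y\<in>carrier G. e \<otimes> f (g y) = f (g y) \<otimes> e)"
    unfolding M_set_def using one_closed by auto
  also have "\<dots> \<longleftrightarrow> (\<forall>y\<in>(\<lambda>y. f (g y)) ` carrier G. e \<otimes> y = y \<otimes> e)"
    by auto
  also have "(\<lambda>y. f (g y)) ` carrier G = carrier G"
    using central_automorphism_bij[OF f] central_automorphism_bij[OF g]
    by (simp add: bij_betw_def flip: image_image)
  finally show ?thesis
    using e by (simp add: group_center_def)
qed

end

section \<open>Pointed FG-quasigroups are affine\<close>

lemma transport_group:
  assumes "group G" and c: "bij_betw c S (carrier G)"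
  obtains H :: "'a monoid" where "group H" "carrier H = S" "c \<in> iso H G"
proof -
  interpret G: group G
    by (rule assms(1))
  define c' where "c' = inv_into S c"
  define H where "H = \<lparr>carrier = S, monoid.mult = (\<lambda>x y. c' (c x \<otimes>\<^bsub>G\<^esub> c y)), one = c' \<one>\<^bsub>G\<^esub>\<rparr>"
  have c_closed: "c x \<in> carrier G" and c'_c: "c' (c x) = x" if "x \<in> S" for x
    using that c by (auto simp: c'_def bij_betw_def)
  have c'_closed: "c' y \<in> S" and c_c': "c (c' y) = y" if "y \<in> carrier G" for y
    using that c by (auto simp: c'_def bij_betw_def f_inv_into_f inv_into_into)
  have "group H"
  proof (rule groupI)
    fix x assume x: "x \<in> carrier H"
    then show "\<exists>y\<in>carrier H. y \<otimes>\<^bsub>H\<^esub> x = \<one>\<^bsub>H\<^esub>"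
      by (intro bexI[of _ "c' (inv\<^bsub>G\<^esub> c x)"]) (simp_all add: H_def c_closed c'_closed c_c')
  qed (simp_all add: H_def c_closed c'_closed c_c' c'_c G.m_assoc)
  moreover have "c \<in> iso H G"
    using c by (auto simp: iso_def hom_def H_def c_closed c_c')
  ultimately show ?thesis
    using that[of H] by (simp add: H_def)
qed

text \<open>
  The group is carried over to \<open>Q\<close> along the third bijection of the isotopy, translated so that
  \<open>a\<close> becomes the neutral element. An isotopy can still be changed by inserting \<open>s\<close> and
  its inverse between the two factors; this freedom is used to make \<open>B\<close> fix \<open>a\<close>. Then \<open>A\<close> is
  the right translation by \<open>a\<close>, and \<open>B\<close> is a left translation, so both are permutations.
\<close>

lemma (in FG_quasigroup) principal_isotope:
  assumes a: "a \<in> carrier Q"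
  obtains H :: "'a monoid" and A B where "group H" "carrier H = carrier Q" "\<one>\<^bsub>H\<^esub> = a"
    "bij_betw A (carrier Q) (carrier Q)" "bij_betw B (carrier Q) (carrier Q)" "B a = a"
    "\<And>x y. \<lbrakk>x \<in> carrier Q; y \<in> carrier Q\<rbrakk> \<Longrightarrow> x \<cdot> y = A x \<otimes>\<^bsub>H\<^esub> B y"
proof -
  obtain G :: "'a monoid" and p q r where "group G"
    and p: "bij_betw p (carrier Q) (carrier G)" and q: "bij_betw q (carrier Q) (carrier G)"
    and r: "bij_betw r (carrier Q) (carrier G)"
    and pqr: "\<And>x y. \<lbrakk>x \<in> carrier Q; y \<in> carrier Q\<rbrakk> \<Longrightarrow> r (x \<cdot> y) = p x \<otimes>\<^bsub>G\<^esub> q y"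
    using isotopic_to_group unfolding isotopic_def by auto
  interpret G: group G
    by fact
  have cl: "p x \<in> carrier G" "q x \<in> carrier G" "r x \<in> carrier G" if "x \<in> carrier Q" for x
    using that p q r by (auto simp: bij_betw_def)
  \<comment> \<open>Right multiplication by \<open>t\<close> moves the image of \<open>a\<close> to the neutral element.\<close>
  define t where "t = inv\<^bsub>G\<^esub> r a"
  have t: "t \<in> carrier G"
    using a cl by (simp add: t_def)
  define c where "c = (\<lambda>y. y \<otimes>\<^bsub>G\<^esub> t) \<circ> r"
  have c: "bij_betw c (carrier Q) (carrier G)"
    unfolding c_def using r t by (intro bij_betw_trans[OF r] G.right_mult_bij)
  obtain H :: "'a monoid" where "group H" and H: "carrier H = carrier Q" and iso: "c \<in> iso H G"
    by (rule transport_group[OF \<open>group G\<close> c])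
  interpret H: group H
    by fact
  have c_inj: "x = y" if "c x = c y" "x \<in> carrier Q" "y \<in> carrier Q" for x y
    using that c by (auto simp: bij_betw_def inj_on_def)
  have c_mult: "c (x \<otimes>\<^bsub>H\<^esub> y) = c x \<otimes>\<^bsub>G\<^esub> c y" if "x \<in> carrier Q" "y \<in> carrier Q" for x y
    using that iso H by (simp add: iso_def hom_mult)
  have c_a: "c a = \<one>\<^bsub>G\<^esub>"
    using a cl by (simp add: c_def t_def)
  have one: "\<one>\<^bsub>H\<^esub> = a"
  proof (rule c_inj)
    have "c \<in> hom H G"
      using iso by (simp add: iso_def)
    then show "c \<one>\<^bsub>H\<^esub> = c a"
      using hom_one[OF _ \<open>group H\<close> \<open>group G\<close>] c_a by simp
  qed (use a H H.one_closed in auto)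
  \<comment> \<open>The element to be inserted between the factors; its inverse cancels \<open>q a \<otimes> t\<close>, whence \<open>B a = a\<close>.\<close>
  define s where "s = q a \<otimes>\<^bsub>G\<^esub> t"
  have s: "s \<in> carrier G"
    using a cl t by (simp add: s_def)
  define A where "A x = inv_into (carrier Q) c (p x \<otimes>\<^bsub>G\<^esub> s)" for x
  define B where "B y = inv_into (carrier Q) c (inv\<^bsub>G\<^esub> s \<otimes>\<^bsub>G\<^esub> (q y \<otimes>\<^bsub>G\<^esub> t))" for y
  have inv_c: "inv_into (carrier Q) c y \<in> carrier Q" "c (inv_into (carrier Q) c y) = y"
    if "y \<in> carrier G" for y
    using that c by (auto simp: bij_betw_def f_inv_into_f inv_into_into)
  have A: "A x \<in> carrier Q" "c (A x) = p x \<otimes>\<^bsub>G\<^esub> s" if "x \<in> carrier Q" for x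
    unfolding A_def using that cl s by (simp_all add: inv_c)
  have B: "B y \<in> carrier Q" "c (B y) = inv\<^bsub>G\<^esub> s \<otimes>\<^bsub>G\<^esub> (q y \<otimes>\<^bsub>G\<^esub> t)" if "y \<in> carrier Q" for y
    unfolding B_def using that cl s t by (simp_all add: inv_c)
  have op: "x \<cdot> y = A x \<otimes>\<^bsub>H\<^esub> B y" if x: "x \<in> carrier Q" and y: "y \<in> carrier Q" for x y
  proof (rule c_inj)
    have "c (x \<cdot> y) = p x \<otimes>\<^bsub>G\<^esub> q y \<otimes>\<^bsub>G\<^esub> t"
      using x y by (simp add: c_def pqr)
    then show "c (x \<cdot> y) = c (A x \<otimes>\<^bsub>H\<^esub> B y)"
      using x y s t cl by (simp add: c_mult A B G.m_assoc)
    show "A x \<otimes>\<^bsub>H\<^esub> B y \<in> carrier Q"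
      using H.m_closed[of "A x" "B y"] A B x y H by simp
  qed (use x y op_closed in auto)
  have B_a: "B a = a"
  proof (rule c_inj)
    show "c (B a) = c a"
      using s unfolding B(2)[OF a] s_def[symmetric] c_a by (rule G.l_inv)
  qed (use a B(1) in auto)
  have bij_A: "bij_betw A (carrier Q) (carrier Q)"
  proof -
    have "x \<cdot> a = A x" if "x \<in> carrier Q" for x
      using that a op[OF that a] B_a A H one H.r_one[of "A x"] by simp
    then have "bij_betw (\<lambda>x. x \<cdot> a) (carrier Q) (carrier Q) \<longleftrightarrow> bij_betw A (carrier Q) (carrier Q)"
      by (rule bij_betw_cong)
    then show ?thesis
      using right_translation[OF a] by blast
  qed
  have bij_B: "bij_betw B (carrier Q) (carrier Q)"
  proof -
    have "a \<in> A ` carrier Q"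
      using bij_A a by (simp add: bij_betw_def)
    then obtain u where u: "u \<in> carrier Q" "A u = a"
      by auto
    have "u \<cdot> y = B y" if "y \<in> carrier Q" for y
      using that u op[OF u(1) that] B H one H.l_one[of "B y"] by simp
    then have "bij_betw (\<lambda>y. u \<cdot> y) (carrier Q) (carrier Q) \<longleftrightarrow> bij_betw B (carrier Q) (carrier Q)"
      by (rule bij_betw_cong)
    then show ?thesis
      using left_translation[OF u(1)] by blast
  qed
  show ?thesis
    using \<open>group H\<close> H one bij_A bij_B B_a op by (rule that)
qed

text \<open>
  Inserting \<open>k\<close> and its inverse into the product turns the shifted law into additivity.
\<close>

lemma (in group) hom_by_translation:
  assumes k: "k \<in> carrier G" and h: "\<And>x. x \<in> carrier G \<Longrightarrow> h x \<in> carrier G"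
    and split: "\<And>x y. \<lbrakk>x \<in> carrier G; y \<in> carrier G\<rbrakk>
      \<Longrightarrow> h (x \<otimes> y) = h (x \<otimes> inv k) \<otimes> h (k \<otimes> y)"
  shows "h \<in> hom G G"
proof (rule homI)
  fix x y assume x: "x \<in> carrier G" and y: "y \<in> carrier G"
  have "h (x \<otimes> y) = h ((x \<otimes> k) \<otimes> (inv k \<otimes> y))"
    using k x y by (simp add: m_assoc)
  also have "\<dots> = h (x \<otimes> k \<otimes> inv k) \<otimes> h (k \<otimes> (inv k \<otimes> y))"
    using k x y by (intro split) simp_all
  finally show "h (x \<otimes> y) = h x \<otimes> h y"
    using k x y by (simp add: m_assoc)
qed (rule h)

text \<open>
  Write \<open>v = f x + e\<close>, an arbitrary element of the group. The left F-law at a triple \<open>x, y, 0\<close> reads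
  \<open>v + g (f y) = f v + f (g y) + d\<close>, with \<open>d\<close> independent of \<open>y\<close>. For \<open>y = 0\<close> it gives
  \<open>v = f v + d\<close>, and comparing the two, \<open>d + g (f y) = f (g y) + d\<close>. For \<open>v = 0\<close> the element \<open>d\<close> is
  \<open>0\<close>, so \<open>f\<close> and \<open>g\<close> commute; then for every \<open>v\<close> the element \<open>d\<close> is central, and it
  is the inverse of the displacement of \<open>f\<close> at \<open>v\<close>. The right F-law at \<open>x, y, 0\<close> treats \<open>g\<close> in the
  same way, with \<open>v = e + g x\<close>.
\<close>

lemma (in F_quasigroup) affine_imp_central:
  assumes "group H" and H: "carrier H = carrier Q"
    and f: "f \<in> iso H H" and g: "g \<in> iso H H" and e: "e \<in> carrier H"
    and op: "\<And>x y. \<lbrakk>x \<in> carrier H; y \<in> carrier H\<rbrakk> \<Longrightarrow> x \<cdot> y = f x \<otimes>\<^bsub>H\<^esub> e \<otimes>\<^bsub>H\<^esub> g y"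
  shows "central_automorphism_pair H f g"
proof -
  interpret H: group H
    by fact
  have hom: "f \<in> hom H H" "g \<in> hom H H"
    using f g by (simp_all add: iso_def)
  have im: "f ` carrier H = carrier H" "g ` carrier H = carrier H"
    using f g by (simp_all add: iso_def bij_betw_def)
  have cl [simp]: "f x \<in> carrier H" "g x \<in> carrier H" if "x \<in> carrier H" for x
    using that im by auto
  note fg_mult = hom_mult[OF hom(1)] hom_mult[OF hom(2)]
  note fg_one = H.hom_self_one[OF hom(1)] H.hom_self_one[OF hom(2)]
  have Q_cl: "x \<cdot> y \<in> carrier H" if "x \<in> carrier H" "y \<in> carrier H" for x y
    using that H op_closed by simp
  have fg_surj: "\<exists>y\<in>carrier H. f (g y) = x" if "x \<in> carrier H" for x
    using that im by (metis imageE)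
  have left: "\<exists>d\<in>carrier H. v = f v \<otimes>\<^bsub>H\<^esub> d \<and>
      (\<forall>y\<in>carrier H. d \<otimes>\<^bsub>H\<^esub> g (f y) = f (g y) \<otimes>\<^bsub>H\<^esub> d)"
    if v: "v \<in> carrier H" for v
  proof -
    have "v \<otimes>\<^bsub>H\<^esub> inv\<^bsub>H\<^esub> e \<in> f ` carrier H"
      using v e im by simp
    then obtain x where x: "x \<in> carrier H" and "f x = v \<otimes>\<^bsub>H\<^esub> inv\<^bsub>H\<^esub> e"
      by auto
    then have v_x: "f x \<otimes>\<^bsub>H\<^esub> e = v"
      using v e by (simp add: H.m_assoc)
    define u where "u = \<alpha> x"
    have u: "u \<in> carrier H"
      using local_right_unit[of x] x H by (simp add: u_def)
    define d where "d = e \<otimes>\<^bsub>H\<^esub> g (f u)"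
    have d: "d \<in> carrier H"
      using e u by (simp add: d_def)
    have eq: "v \<otimes>\<^bsub>H\<^esub> g (f y) = f v \<otimes>\<^bsub>H\<^esub> (f (g y) \<otimes>\<^bsub>H\<^esub> d)" if y: "y \<in> carrier H" for y
    proof -
      have "x \<cdot> (y \<cdot> \<one>\<^bsub>H\<^esub>) = (x \<cdot> y) \<cdot> (u \<cdot> \<one>\<^bsub>H\<^esub>)"
        unfolding u_def using x y H.one_closed unfolding H by (rule left_F)
      then have "v \<otimes>\<^bsub>H\<^esub> g (f y) \<otimes>\<^bsub>H\<^esub> g e = f v \<otimes>\<^bsub>H\<^esub> (f (g y) \<otimes>\<^bsub>H\<^esub> d) \<otimes>\<^bsub>H\<^esub> g e"
        using x y u e v Q_cl by (simp add: op v_x fg_one fg_mult d_def H.m_assoc)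
      then show ?thesis
        using y v d e by simp
    qed
    have v_d: "v = f v \<otimes>\<^bsub>H\<^esub> d"
      using eq[OF H.one_closed] v d by (simp add: fg_one)
    have "d \<otimes>\<^bsub>H\<^esub> g (f y) = f (g y) \<otimes>\<^bsub>H\<^esub> d" if y: "y \<in> carrier H" for y
    proof -
      have "f v \<otimes>\<^bsub>H\<^esub> (d \<otimes>\<^bsub>H\<^esub> g (f y)) = f v \<otimes>\<^bsub>H\<^esub> (f (g y) \<otimes>\<^bsub>H\<^esub> d)"
        using eq[OF y] v_d y v d by (simp add: H.m_assoc[symmetric])
      then show ?thesis
        using y v d by simp
    qed
    then show ?thesis
      using d v_d by blast
  qed
  have fg: "f (g y) = g (f y)" if y: "y \<in> carrier H" for y
    using left[OF H.one_closed] y by (auto simp: fg_one)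
  have f_central: "displacement H f v \<in> group_center H" if v: "v \<in> carrier H" for v
  proof -
    obtain d where d: "d \<in> carrier H" and v_d: "v = f v \<otimes>\<^bsub>H\<^esub> d"
      and comm: "\<And>y. y \<in> carrier H \<Longrightarrow> d \<otimes>\<^bsub>H\<^esub> g (f y) = f (g y) \<otimes>\<^bsub>H\<^esub> d"
      using left[OF v] by blast
    have "d \<otimes>\<^bsub>H\<^esub> x = x \<otimes>\<^bsub>H\<^esub> d" if x: "x \<in> carrier H" for x
      using fg_surj[OF x] comm fg by metis
    then have "d \<in> group_center H"
      using d by (simp add: group_center_def)
    moreover have "displacement H f v = inv\<^bsub>H\<^esub> d"
    proof -
      have "inv\<^bsub>H\<^esub> v = inv\<^bsub>H\<^esub> (f v \<otimes>\<^bsub>H\<^esub> d)"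
        using v_d by simp
      then show ?thesis
        using v d by (simp add: displacement_def H.inv_mult_group H.m_assoc)
    qed
    ultimately show ?thesis
      using H.center_inv by simp
  qed
  have g_central: "displacement H g v \<in> group_center H" if v: "v \<in> carrier H" for v
  proof -
    have "inv\<^bsub>H\<^esub> e \<otimes>\<^bsub>H\<^esub> v \<in> g ` carrier H"
      using v e im by simp
    then obtain x where x: "x \<in> carrier H" and "g x = inv\<^bsub>H\<^esub> e \<otimes>\<^bsub>H\<^esub> v"
      by auto
    then have v_x: "e \<otimes>\<^bsub>H\<^esub> g x = v"
      using v e by simp
    define u where "u = \<beta> x"
    have u: "u \<in> carrier H"
      using local_left_unit[of x] x H by (simp add: u_def)
    define d where "d = f (g u) \<otimes>\<^bsub>H\<^esub> e"
    have d: "d \<in> carrier H"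
      using e u by (simp add: d_def)
    have eq: "f (g y) \<otimes>\<^bsub>H\<^esub> v = d \<otimes>\<^bsub>H\<^esub> (f (g y) \<otimes>\<^bsub>H\<^esub> g v)" if y: "y \<in> carrier H" for y
    proof -
      have "(\<one>\<^bsub>H\<^esub> \<cdot> y) \<cdot> x = (\<one>\<^bsub>H\<^esub> \<cdot> u) \<cdot> (y \<cdot> x)"
        unfolding u_def using x y H.one_closed unfolding H by (intro right_F)
      moreover have "(\<one>\<^bsub>H\<^esub> \<cdot> y) \<cdot> x = f e \<otimes>\<^bsub>H\<^esub> (f (g y) \<otimes>\<^bsub>H\<^esub> v)"
        using x y e Q_cl by (simp add: op fg_one fg_mult H.m_assoc flip: v_x)
      moreover have "(\<one>\<^bsub>H\<^esub> \<cdot> u) \<cdot> (y \<cdot> x) = f e \<otimes>\<^bsub>H\<^esub> (d \<otimes>\<^bsub>H\<^esub> (f (g y) \<otimes>\<^bsub>H\<^esub> g v))"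
        using x y u e Q_cl by (simp add: op fg_one fg_mult d_def H.m_assoc fg flip: v_x)
      ultimately show ?thesis
        using y v d e by simp
    qed
    have v_d: "v = d \<otimes>\<^bsub>H\<^esub> g v"
      using eq[OF H.one_closed] v d by (simp add: fg_one)
    have "d \<otimes>\<^bsub>H\<^esub> f (g y) = f (g y) \<otimes>\<^bsub>H\<^esub> d" if y: "y \<in> carrier H" for y
    proof -
      have "f (g y) \<otimes>\<^bsub>H\<^esub> d \<otimes>\<^bsub>H\<^esub> g v = f (g y) \<otimes>\<^bsub>H\<^esub> (d \<otimes>\<^bsub>H\<^esub> g v)"
        using y d v by (simp add: H.m_assoc)
      also have "\<dots> = d \<otimes>\<^bsub>H\<^esub> f (g y) \<otimes>\<^bsub>H\<^esub> g v"
        using eq[OF y] y d v by (simp add: H.m_assoc flip: v_d)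
      finally show ?thesis
        using y d v by simp
    qed
    then have "d \<otimes>\<^bsub>H\<^esub> x = x \<otimes>\<^bsub>H\<^esub> d" if "x \<in> carrier H" for x
      using fg_surj[OF that] by metis
    then have dZ: "d \<in> group_center H"
      using d by (simp add: group_center_def)
    have "displacement H g v = inv\<^bsub>H\<^esub> d"
    proof -
      have "v = g v \<otimes>\<^bsub>H\<^esub> d"
        using v_d H.center_comm[OF dZ, of "g v"] v by simp
      then have "inv\<^bsub>H\<^esub> v = inv\<^bsub>H\<^esub> (g v \<otimes>\<^bsub>H\<^esub> d)"
        by simp
      then show ?thesis
        using v d by (simp add: displacement_def H.inv_mult_group H.m_assoc)
    qed
    then show ?thesis
      using H.center_inv[OF dZ] by simp
  qed
  show ?thesis
    using f g f_central g_central fg by unfold_locales (simp_all add: central_automorphism_def)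
qed

text \<open>
  Start from \<open>x \<cdot> y = A x + B y\<close> with \<open>B 0 = 0\<close>. For a fixed first argument the left F-law is an
  identity \<open>B (x + z) = t + B (k + z)\<close> with \<open>t\<close> depending only on \<open>x\<close> and \<open>k\<close> constant.
  Taking \<open>z = - k\<close> identifies \<open>t\<close> as \<open>B (x - k)\<close>, so \<open>B\<close> is an automorphism. The right F-law shows
  in the same way that \<open>A\<close> is an automorphism followed by the right translation by \<open>e = A 0\<close>.
\<close>

lemma (in FG_quasigroup) affine_form:
  assumes a: "a \<in> carrier Q"
  obtains H :: "'a monoid" and f g e where "central_automorphism_pair H f g" "e \<in> carrier H"
    "\<one>\<^bsub>H\<^esub> = a" "Q = affine_quasigroup H f g e"
proof -
  obtain H :: "'a monoid" and A B where "group H" and H: "carrier H = carrier Q" and one: "\<one>\<^bsub>H\<^esub> = a"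
    and "bij_betw A (carrier Q) (carrier Q)" "bij_betw B (carrier Q) (carrier Q)" and B_a: "B a = a"
    and "\<And>x y. \<lbrakk>x \<in> carrier Q; y \<in> carrier Q\<rbrakk> \<Longrightarrow> x \<cdot> y = A x \<otimes>\<^bsub>H\<^esub> B y"
    using principal_isotope[OF a] by blast
  then have A: "bij_betw A (carrier H) (carrier H)" and B: "bij_betw B (carrier H) (carrier H)"
    and op: "\<And>x y. \<lbrakk>x \<in> carrier H; y \<in> carrier H\<rbrakk> \<Longrightarrow> x \<cdot> y = A x \<otimes>\<^bsub>H\<^esub> B y"
    by simp_all
  interpret H: group H
    by fact
  have aH: "a \<in> carrier H"
    using a H by simp
  have cl [simp]: "A x \<in> carrier H" "B x \<in> carrier H" if "x \<in> carrier H" for x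
    using that A B by (auto simp: bij_betw_def)
  \<comment> \<open>Surjectivity lets arbitrary group elements be substituted for \<open>A x\<close> and \<open>B y\<close> in the F-laws.\<close>
  have A_surj: "\<exists>y\<in>carrier H. A y = x" and B_surj: "\<exists>y\<in>carrier H. B y = x"
    if "x \<in> carrier H" for x
    using that A B unfolding bij_betw_def by (metis imageE)+
  have Q_cl: "x \<cdot> y \<in> carrier H" if "x \<in> carrier H" "y \<in> carrier H" for x y
    using that H op_closed by simp
  have B_one: "B \<one>\<^bsub>H\<^esub> = \<one>\<^bsub>H\<^esub>"
    using one B_a by simp
  have B_hom: "B \<in> hom H H"
  proof (rule H.hom_by_translation)
    define u where "u = \<alpha> a"
    have u: "u \<in> carrier H"
      using local_right_unit[OF a] by (simp add: u_def H)
    show "A u \<in> carrier H"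
      using u by simp
    fix x y assume x: "x \<in> carrier H" and y: "y \<in> carrier H"
    obtain x' where x': "x' \<in> carrier H" "A x' = x"
      using A_surj[OF x] by blast
    define t where "t = inv\<^bsub>H\<^esub> A a \<otimes>\<^bsub>H\<^esub> A (a \<cdot> x')"
    have t: "t \<in> carrier H"
      using aH x' Q_cl by (simp add: t_def)
    have *: "B (x \<otimes>\<^bsub>H\<^esub> z) = t \<otimes>\<^bsub>H\<^esub> B (A u \<otimes>\<^bsub>H\<^esub> z)" if z: "z \<in> carrier H" for z
    proof -
      obtain z' where z': "z' \<in> carrier H" "B z' = z"
        using B_surj[OF z] by blast
      have "a \<cdot> (x' \<cdot> z') = (a \<cdot> x') \<cdot> (u \<cdot> z')"
        unfolding u_def using a x'(1) z'(1) unfolding H by (rule left_F)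
      moreover have "a \<cdot> (x' \<cdot> z') = A a \<otimes>\<^bsub>H\<^esub> B (x \<otimes>\<^bsub>H\<^esub> z)"
        using op[of a "x' \<cdot> z'"] op[of x' z'] x' z' x z aH Q_cl by simp
      moreover have "(a \<cdot> x') \<cdot> (u \<cdot> z') = A (a \<cdot> x') \<otimes>\<^bsub>H\<^esub> B (A u \<otimes>\<^bsub>H\<^esub> z)"
        using op[of "a \<cdot> x'" "u \<cdot> z'"] op[of u z'] x' z' x z aH u Q_cl by simp
      ultimately have "A a \<otimes>\<^bsub>H\<^esub> B (x \<otimes>\<^bsub>H\<^esub> z) = A (a \<cdot> x') \<otimes>\<^bsub>H\<^esub> B (A u \<otimes>\<^bsub>H\<^esub> z)"
        by simp
      then have "inv\<^bsub>H\<^esub> A a \<otimes>\<^bsub>H\<^esub> (A a \<otimes>\<^bsub>H\<^esub> B (x \<otimes>\<^bsub>H\<^esub> z)) = t \<otimes>\<^bsub>H\<^esub> B (A u \<otimes>\<^bsub>H\<^esub> z)"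
        using aH x' u z Q_cl by (simp add: t_def H.m_assoc)
      then show ?thesis
        using aH x z by simp
    qed
    \<comment> \<open>Here \<open>k = A u\<close>, and \<open>B\<close> preserves the neutral element.\<close>
  have "B (x \<otimes>\<^bsub>H\<^esub> inv\<^bsub>H\<^esub> A u) = t"
      using *[of "inv\<^bsub>H\<^esub> A u"] u t by (simp add: B_one)
    then show "B (x \<otimes>\<^bsub>H\<^esub> y) = B (x \<otimes>\<^bsub>H\<^esub> inv\<^bsub>H\<^esub> A u) \<otimes>\<^bsub>H\<^esub> B (A u \<otimes>\<^bsub>H\<^esub> y)"
      using *[OF y] by simp
  qed simp
  define e where "e = A a"
  have e: "e \<in> carrier H"
    using aH by (simp add: e_def)
  define f where "f x = A x \<otimes>\<^bsub>H\<^esub> inv\<^bsub>H\<^esub> e" for x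
  have A_f: "A x = f x \<otimes>\<^bsub>H\<^esub> e" if "x \<in> carrier H" for x
    using that e by (simp add: f_def H.m_assoc)
  have f_closed: "f x \<in> carrier H" if "x \<in> carrier H" for x
    using that e by (simp add: f_def)
  have f_hom: "f \<in> hom H H"
  proof (rule H.hom_by_translation)
    define u where "u = \<beta> a"
    have u: "u \<in> carrier H"
      using local_left_unit[OF a] by (simp add: u_def H)
    have Bu: "B u \<in> carrier H"
      using u by simp
    then show "inv\<^bsub>H\<^esub> B u \<in> carrier H"
      by simp
    fix x y assume x: "x \<in> carrier H" and y: "y \<in> carrier H"
    obtain y' where y': "y' \<in> carrier H" "B y' = y"
      using B_surj[OF y] by blast
    define t where "t = B (A y')"
    have t: "t \<in> carrier H"
      using y' by (simp add: t_def)
    have *: "A (z \<otimes>\<^bsub>H\<^esub> y) = A (z \<otimes>\<^bsub>H\<^esub> B u) \<otimes>\<^bsub>H\<^esub> t" if z: "z \<in> carrier H" for z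
    proof -
      obtain z' where z': "z' \<in> carrier H" "A z' = z"
        using A_surj[OF z] by blast
      have "(z' \<cdot> y') \<cdot> a = (z' \<cdot> u) \<cdot> (y' \<cdot> a)"
        unfolding u_def using a y'(1) z'(1) unfolding H by (intro right_F)
      moreover have "(z' \<cdot> y') \<cdot> a = A (z \<otimes>\<^bsub>H\<^esub> y)"
        using op[of "z' \<cdot> y'" a] op[of z' y'] y' z' aH Q_cl z y B_a one
          H.r_one[of "A (z \<otimes>\<^bsub>H\<^esub> y)"] by simp
      moreover have "y' \<cdot> a = A y'"
        using op[of y' a] y' aH B_a one H.r_one[of "A y'"] by simp
      then have "(z' \<cdot> u) \<cdot> (y' \<cdot> a) = A (z \<otimes>\<^bsub>H\<^esub> B u) \<otimes>\<^bsub>H\<^esub> t"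
        using op[of "z' \<cdot> u" "A y'"] op[of z' u] y' z' z u Q_cl by (simp add: t_def)
      ultimately show ?thesis
        by simp
    qed
    have "A (inv\<^bsub>H\<^esub> B u \<otimes>\<^bsub>H\<^esub> y) = e \<otimes>\<^bsub>H\<^esub> t"
      using *[of "inv\<^bsub>H\<^esub> B u"] Bu by (simp add: one e_def)
    then have "t = inv\<^bsub>H\<^esub> e \<otimes>\<^bsub>H\<^esub> A (inv\<^bsub>H\<^esub> B u \<otimes>\<^bsub>H\<^esub> y)"
      using t e by simp
    then show "f (x \<otimes>\<^bsub>H\<^esub> y) = f (x \<otimes>\<^bsub>H\<^esub> inv\<^bsub>H\<^esub> (inv\<^bsub>H\<^esub> B u)) \<otimes>\<^bsub>H\<^esub> f (inv\<^bsub>H\<^esub> B u \<otimes>\<^bsub>H\<^esub> y)"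
      using *[OF x] x y Bu e by (simp add: f_def H.m_assoc)
  qed (rule f_closed)
  have "bij_betw ((\<lambda>x. x \<otimes>\<^bsub>H\<^esub> inv\<^bsub>H\<^esub> e) \<circ> A) (carrier H) (carrier H)"
    using e by (intro bij_betw_trans[OF A] H.right_mult_bij) simp
  then have "bij_betw f (carrier H) (carrier H)"
    by (simp add: f_def[abs_def] comp_def)
  then have f_iso: "f \<in> iso H H" and B_iso: "B \<in> iso H H"
    using f_hom B_hom B by (simp_all add: iso_def)
  have op': "x \<cdot> y = f x \<otimes>\<^bsub>H\<^esub> e \<otimes>\<^bsub>H\<^esub> B y" if "x \<in> carrier H" "y \<in> carrier H" for x y
    using that op A_f by simp
  have pair: "central_automorphism_pair H f B"
    by (rule affine_imp_central[OF \<open>group H\<close> H f_iso B_iso e op'])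
  have "Q = affine_quasigroup H f B e"
  proof (rule magma.equality)
    show "op Q = op (affine_quasigroup H f B e)"
      using op' op_undefined H by (intro ext) (auto simp: affine_quasigroup_def)
  qed (simp_all add: H)
  then show ?thesis
    using that pair e one by blast
qed

section \<open>Homomorphisms\<close>

text \<open>
  The distinguished element \<open>e\<close> is recovered from the quasigroup as the square of the neutral
  element, so no information is lost when the neutral element becomes the new base point.
\<close>

definition associated_quasigroup :: "'a pointed_R_module \<Rightarrow> 'a pointed_magma"
  where "associated_quasigroup = (\<lambda>(G, e).
    (affine_quasigroup G (one_plus G X) (one_plus G Y) e, \<one>\<^bsub>G\<^esub>))"

text \<open>
  Since \<open>\<phi>\<close> preserves the neutral elements, putting zeros into
  \<open>\<phi> (f x + e + g y) = f (\<phi> x) + e' + g (\<phi> y)\<close> splits it: \<open>x = y = 0\<close> shows that \<open>\<phi>\<close> maps \<open>e\<close> to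
  \<open>e'\<close>, and \<open>y = 0\<close> shows \<open>\<phi> (f x + e) = f (\<phi> x) + e'\<close>. As \<open>f x + e\<close> and \<open>g y\<close> are arbitrary, \<open>\<phi>\<close> is additive
  and commutes with \<open>f\<close> and \<open>g\<close>, hence with their inverses, hence with all four
  indeterminates and with everything that they generate.
\<close>

lemma quasigroup_hom_imp_module_hom:
  assumes "(G, e) \<in> M_p" "(H, e') \<in> M_p"
    and "pointed_quasigroup_hom (associated_quasigroup (G, e)) (associated_quasigroup (H, e')) \<phi>"
  shows "pointed_R_module_hom (G, e) (H, e') \<phi>"
proof -
  interpret G: M_class_module G
    using assms(1) by unfold_locales (simp add: M_p_def)
  interpret H: M_class_module H
    using assms(2) by unfold_locales (simp add: M_p_def)
  have e: "e \<in> carrier G" and e': "e' \<in> carrier H"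
    using assms(1,2) by (simp_all add: M_p_def)
  have \<phi>_closed [simp]: "\<phi> x \<in> carrier H" if "x \<in> carrier G" for x
    using that assms(3) by (auto simp: pointed_quasigroup_hom_def associated_quasigroup_def)
  have \<phi>_one: "\<phi> \<one>\<^bsub>G\<^esub> = \<one>\<^bsub>H\<^esub>"
    using assms(3) by (simp add: pointed_quasigroup_hom_def associated_quasigroup_def)
  have \<phi>_op: "\<phi> (one_plus G X x \<otimes>\<^bsub>G\<^esub> e \<otimes>\<^bsub>G\<^esub> one_plus G Y y)
      = one_plus H X (\<phi> x) \<otimes>\<^bsub>H\<^esub> e' \<otimes>\<^bsub>H\<^esub> one_plus H Y (\<phi> y)"
    if "x \<in> carrier G" "y \<in> carrier G" for x y
    using that assms(3)
    by (simp add: pointed_quasigroup_hom_def associated_quasigroup_def op_affine_quasigroup)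
  have surj: "\<exists>y\<in>carrier G. one_plus G i y = x" if "x \<in> carrier G" for x i
    using that G.central_automorphism_bij[OF G.one_plus_central_automorphism[of i]]
    unfolding bij_betw_def by (metis imageE)
  have right: "\<phi> (one_plus G X x \<otimes>\<^bsub>G\<^esub> e) = one_plus H X (\<phi> x) \<otimes>\<^bsub>H\<^esub> e'"
    if x: "x \<in> carrier G" for x
    using \<phi>_op[OF x G.one_closed] x e e' by (simp add: G.fg_one H.fg_one \<phi>_one)
  have \<phi>_e: "\<phi> e = e'"
    using right[OF G.one_closed] e e' by (simp add: G.fg_one H.fg_one \<phi>_one)
  have split: "\<phi> (x \<otimes>\<^bsub>G\<^esub> one_plus G Y y) = \<phi> x \<otimes>\<^bsub>H\<^esub> one_plus H Y (\<phi> y)"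
    if x: "x \<in> carrier G" and y: "y \<in> carrier G" for x y
  proof -
    obtain x' where x': "x' \<in> carrier G" and "one_plus G X x' = x \<otimes>\<^bsub>G\<^esub> inv\<^bsub>G\<^esub> e"
      using surj[of "x \<otimes>\<^bsub>G\<^esub> inv\<^bsub>G\<^esub> e" X] x e by auto
    then have "one_plus G X x' \<otimes>\<^bsub>G\<^esub> e = x"
      using x e by (simp add: G.m_assoc)
    then show ?thesis
      using \<phi>_op[OF x' y] right[OF x'] by simp
  qed
  have Y: "\<phi> (one_plus G Y y) = one_plus H Y (\<phi> y)" if y: "y \<in> carrier G" for y
    using split[OF G.one_closed y] y by (simp add: \<phi>_one)
  have mult: "\<phi> (x \<otimes>\<^bsub>G\<^esub> y) = \<phi> x \<otimes>\<^bsub>H\<^esub> \<phi> y" if x: "x \<in> carrier G" and y: "y \<in> carrier G" for x y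
  proof -
    obtain y' where "y' \<in> carrier G" "one_plus G Y y' = y"
      using surj[OF y] by blast
    then show ?thesis
      using split[OF x, of y'] Y[of y'] by simp
  qed
  have X: "\<phi> (one_plus G X x) = one_plus H X (\<phi> x)" if x: "x \<in> carrier G" for x
    using right[OF x] mult[OF _ e, of "one_plus G X x"] x e e' by (simp add: \<phi>_e)
  have inverse: "\<phi> (one_plus G j x) = one_plus H j (\<phi> x)"
    if ij: "(i, j) \<in> {(X, U), (Y, V)}" and x: "x \<in> carrier G" for i j x
  proof -
    have "\<phi> x = \<phi> (one_plus G i (one_plus G j x))"
      using G.one_plus_inverse[of i j x] ij x by auto
    also have "\<dots> = one_plus H i (\<phi> (one_plus G j x))"
      using X Y ij x G.one_plus_closed by auto
    finally have "one_plus H j (\<phi> x) = one_plus H j (one_plus H i (\<phi> (one_plus G j x)))"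
      by simp
    also have "\<dots> = \<phi> (one_plus G j x)"
      using H.one_plus_inverse[of j i "\<phi> (one_plus G j x)"] ij x G.one_plus_closed by auto
    finally show ?thesis
      by simp
  qed
  have \<phi>_one_plus: "\<phi> (one_plus G i x) = one_plus H i (\<phi> x)" if "x \<in> carrier G" for i x
    using that X Y inverse by (cases i) auto
  have \<phi>_hom: "\<phi> \<in> hom G H"
    using mult by (intro homI) simp_all
  interpret \<phi>: group_hom G H \<phi>
    by unfold_locales (rule \<phi>_hom)
  have "\<phi> (r \<bullet>\<^bsub>G\<^esub> x) = r \<bullet>\<^bsub>H\<^esub> \<phi> x" if "r \<in> ideal_R" "x \<in> carrier G" for r x
    using that
  proof (induction r arbitrary: x rule: ideal_R_induct)
    case zero
    then show ?case
      by (simp add: G.zero_scale H.zero_scale)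
  next
    case (indet i)
    then show ?case
      using \<phi>_one_plus[of x i]
      by (simp add: one_plus_def mult G.scale_closed H.scale_closed indet_in_ideal_R)
  next
    case (diff r s)
    then show ?case
      by (simp add: G.diff_scale H.diff_scale mult G.scale_closed)
  next
    case (mult r s)
    then show ?case
      by (simp add: G.scale_closed flip: G.scale_scale H.scale_scale)
  qed
  then show ?thesis
    using \<phi>_hom \<phi>_e by (simp add: pointed_R_module_hom_def gmodule_hom_def)
qed

lemma module_hom_imp_quasigroup_hom:
  assumes "(G, e) \<in> M_p" "(H, e') \<in> M_p"
    and "pointed_R_module_hom (G, e) (H, e') \<phi>"
  shows "pointed_quasigroup_hom (associated_quasigroup (G, e)) (associated_quasigroup (H, e')) \<phi>"
proof -
  interpret G: M_class_module G
    using assms(1) by unfold_locales (simp add: M_p_def)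
  interpret H: M_class_module H
    using assms(2) by unfold_locales (simp add: M_p_def)
  have e: "e \<in> carrier G"
    using assms(1) by (simp add: M_p_def)
  have \<phi>: "\<phi> \<in> hom G H" "\<phi> e = e'"
    "\<And>r x. \<lbrakk>r \<in> ideal_R; x \<in> carrier G\<rbrakk> \<Longrightarrow> \<phi> (r \<bullet>\<^bsub>G\<^esub> x) = r \<bullet>\<^bsub>H\<^esub> \<phi> x"
    using assms(3) by (simp_all add: pointed_R_module_hom_def gmodule_hom_def)
  interpret \<phi>: group_hom G H \<phi>
    by unfold_locales (rule \<phi>(1))
  have "\<phi> (one_plus G i x) = one_plus H i (\<phi> x)" if "x \<in> carrier G" for i x
    using that by (simp add: one_plus_def \<phi>(3) G.scale_closed indet_in_ideal_R)
  then show ?thesis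
    using e \<phi>(2) by (simp add: pointed_quasigroup_hom_def associated_quasigroup_def
        op_affine_quasigroup Pi_iff G.one_plus_closed)
qed

section \<open>The equivalence\<close>

lemma associated_quasigroup_in_F_gp:
  assumes "A \<in> M_p"
  shows "associated_quasigroup A \<in> F_gp"
proof -
  obtain G e where A: "A = (G, e)" and "G \<in> M_class" and e: "e \<in> carrier G"
    using assms by (auto simp: M_p_def)
  then interpret M_class_module G
    by unfold_locales
  show ?thesis
    using FG_affine_quasigroup[OF e] by (simp add: A F_gp_def associated_quasigroup_def)
qed

lemma associated_quasigroup_in_F_gm_iff:
  assumes "A \<in> M_p"
  shows "associated_quasigroup A \<in> F_gm \<longleftrightarrow> A \<in> M_c"
proof -
  obtain G e where A: "A = (G, e)" and "G \<in> M_class" and e: "e \<in> carrier G"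
    using assms by (auto simp: M_p_def)
  then interpret M_class_module G
    by unfold_locales
  show ?thesis
    using assms associated_quasigroup_in_F_gp[OF assms] M_set_affine_quasigroup[OF e]
    by (simp add: A F_gm_def M_c_def associated_quasigroup_def)
qed

text \<open>
  Homomorphisms already determine the structure: if two modules have the same quasigroup, the identity map
  is a homomorphism of pointed quasigroups, hence of pointed modules.
\<close>

lemma associated_quasigroup_inj: "inj_on associated_quasigroup M_p"
proof (rule inj_onI)
  fix A A' :: "'a pointed_R_module"
  assume A: "A \<in> M_p" and A': "A' \<in> M_p"
    and eq: "associated_quasigroup A = associated_quasigroup A'"
  obtain G e G' e' where A_eq: "A = (G, e)" "A' = (G', e')"
    by (metis surj_pair)
  interpret G: M_class_module G
    using A by unfold_locales (simp add: A_eq M_p_def)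
  interpret G': M_class_module G'
    using A' by unfold_locales (simp add: A_eq M_p_def)
  have carrier: "carrier G = carrier G'"
    using eq by (simp add: A_eq associated_quasigroup_def)
      (metis carrier_affine_quasigroup)
  have "pointed_quasigroup_hom (associated_quasigroup A) (associated_quasigroup A) id"
    by (simp add: pointed_quasigroup_hom_def split: prod.split)
  then have "pointed_R_module_hom (G, e) (G', e') id"
    using quasigroup_hom_imp_module_hom A A' eq unfolding A_eq by metis
  then have hom: "id \<in> hom G G'" and e: "e = e'"
    and scale: "\<And>r x. \<lbrakk>r \<in> ideal_R; x \<in> carrier G\<rbrakk> \<Longrightarrow> r \<bullet>\<^bsub>G\<^esub> x = r \<bullet>\<^bsub>G'\<^esub> x"
    by (simp_all add: pointed_R_module_hom_def gmodule_hom_def)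
  have "G = G'"
  proof (rule gmodule.equality)
    show "(\<otimes>\<^bsub>G\<^esub>) = (\<otimes>\<^bsub>G'\<^esub>)"
    proof (intro ext)
      fix x y
      show "x \<otimes>\<^bsub>G\<^esub> y = x \<otimes>\<^bsub>G'\<^esub> y"
        using hom_mult[OF hom, of x y] G.add_undefined[of x y] G'.add_undefined[of x y] carrier
        by (cases "x \<in> carrier G \<and> y \<in> carrier G") auto
    qed
    show "\<one>\<^bsub>G\<^esub> = \<one>\<^bsub>G'\<^esub>"
      using hom_one[OF hom G.group_axioms G'.group_axioms] by simp
    show "scale G = scale G'"
    proof (intro ext)
      fix r x
      show "r \<bullet>\<^bsub>G\<^esub> x = r \<bullet>\<^bsub>G'\<^esub> x"
        using scale[of r x] G.scale_undefined[of r x] G'.scale_undefined[of r x] carrier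
        by (cases "r \<in> ideal_R \<and> x \<in> carrier G") auto
    qed
  qed (use carrier in simp_all)
  then show "A = A'"
    using e by (simp add: A_eq)
qed

lemma associated_quasigroup_surj:
  assumes "B \<in> F_gp"
  shows "B \<in> associated_quasigroup ` M_p"
proof -
  obtain Q a where B: "B = (Q, a)" and "FG_quasigroup Q" and a: "a \<in> carrier Q"
    using assms by (auto simp: F_gp_def)
  interpret Q: FG_quasigroup Q
    by fact
  obtain H :: "'a monoid" and f g e where pair: "central_automorphism_pair H f g"
    and e: "e \<in> carrier H" and one: "\<one>\<^bsub>H\<^esub> = a" and Q: "Q = affine_quasigroup H f g e"
    by (rule Q.affine_form[OF a])
  interpret central_automorphism_pair H f g
    by (rule pair)
  obtain M :: "'a R_module" where M: "M \<in> M_class" "carrier M = carrier H" "\<one>\<^bsub>M\<^esub> = \<one>\<^bsub>H\<^esub>"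
    and mult: "\<And>x y. \<lbrakk>x \<in> carrier H; y \<in> carrier H\<rbrakk> \<Longrightarrow> x \<otimes>\<^bsub>M\<^esub> y = x \<otimes>\<^bsub>H\<^esub> y"
    and f_eq: "\<And>x. x \<in> carrier H \<Longrightarrow> x \<otimes>\<^bsub>H\<^esub> indet X \<bullet>\<^bsub>M\<^esub> x = f x"
    and g_eq: "\<And>x. x \<in> carrier H \<Longrightarrow> x \<otimes>\<^bsub>H\<^esub> indet Y \<bullet>\<^bsub>M\<^esub> x = g x"
    using ex_module by blast
  interpret M: M_class_module M
    using M(1) by unfold_locales
  have "one_plus M X x = f x" "one_plus M Y x = g x" if "x \<in> carrier H" for x
    using that M mult f_eq g_eq M.scale_closed[OF indet_in_ideal_R] by (simp_all add: one_plus_def)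
  then have "affine_quasigroup M (one_plus M X) (one_plus M Y) e = Q"
    unfolding Q affine_quasigroup_def using M(2) mult e by (auto simp: fun_eq_iff)
  then have "B = associated_quasigroup (M, e)"
    using M(3) one by (simp add: B associated_quasigroup_def)
  moreover have "(M, e) \<in> M_p"
    using M e by (simp add: M_p_def)
  ultimately show ?thesis
    by blast
qed

lemma class_equivalence_inverse:
  assumes "class_equivalence car mor car' mor' \<A> \<B> F"
  shows "class_equivalence car' mor' car mor \<B> \<A> (inv_into \<A> F)"
proof -
  have bij: "bij_betw F \<A> \<B>"
    and car: "\<And>A. A \<in> \<A> \<Longrightarrow> car' (F A) = car A"
    and mor: "\<And>A B \<phi>. \<lbrakk>A \<in> \<A>; B \<in> \<A>; \<phi> \<in> car A \<rightarrow> car B\<rbrakk>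
      \<Longrightarrow> mor A B \<phi> \<longleftrightarrow> mor' (F A) (F B) \<phi>"
    using assms unfolding class_equivalence_def by blast+
  have inv: "inv_into \<A> F B \<in> \<A>" "F (inv_into \<A> F B) = B" if "B \<in> \<B>" for B
    using that bij by (auto simp: bij_betw_def inv_into_into f_inv_into_f)
  have car_inv: "car (inv_into \<A> F B) = car' B" if "B \<in> \<B>" for B
    using car[OF inv(1)[OF that]] inv(2)[OF that] by simp
  show ?thesis
    unfolding class_equivalence_def
    using bij_betw_inv_into[OF bij] car_inv mor inv by simp
qed

lemma class_equivalence_restrict:
  assumes "class_equivalence car mor car' mor' \<A> \<B> F" "\<A>' \<subseteq> \<A>" "F ` \<A>' = \<B>'"
  shows "class_equivalence car mor car' mor' \<A>' \<B>' F"
proof -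
  have "bij_betw F \<A>' \<B>'"
    using assms unfolding class_equivalence_def by (auto intro: bij_betw_subset)
  then show ?thesis
    using assms(1,2) unfolding class_equivalence_def by (simp add: subset_iff)
qed

lemma class_equivalence_associated_quasigroup:
  "class_equivalence (\<lambda>(G, e). carrier G) pointed_R_module_hom
    (\<lambda>(Q, a). carrier Q) pointed_quasigroup_hom M_p F_gp associated_quasigroup"
  unfolding class_equivalence_def
proof (intro conjI ballI)
  show "bij_betw associated_quasigroup M_p F_gp"
    by (intro bij_betw_imageI associated_quasigroup_inj equalityI subsetI)
      (auto intro: associated_quasigroup_in_F_gp associated_quasigroup_surj)
  fix A :: "'a pointed_R_module" assume A: "A \<in> M_p"
  show "(case associated_quasigroup A of (Q, a) \<Rightarrow> carrier Q) = (case A of (G, e) \<Rightarrow> carrier G)"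
    by (simp add: associated_quasigroup_def split: prod.split)
  fix B :: "'a pointed_R_module" and \<phi> assume B: "B \<in> M_p"
  show "pointed_R_module_hom A B \<phi>
    \<longleftrightarrow> pointed_quasigroup_hom (associated_quasigroup A) (associated_quasigroup B) \<phi>"
  proof
    show "pointed_quasigroup_hom (associated_quasigroup A) (associated_quasigroup B) \<phi>"
      if "pointed_R_module_hom A B \<phi>"
      using A B that by (cases A; cases B) (auto intro: module_hom_imp_quasigroup_hom)
    show "pointed_R_module_hom A B \<phi>"
      if "pointed_quasigroup_hom (associated_quasigroup A) (associated_quasigroup B) \<phi>"
      using A B that by (cases A; cases B) (auto intro: quasigroup_hom_imp_module_hom)
  qed
qed

text \<open>
  The correspondence from quasigroups to modules is the inverse of \<open>associated_quasigroup\<close>: the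
  module structure is only shown to exist, whereas the quasigroup is given by a formula.
\<close>

theorem theorem7p1:
  shows "\<exists>\<Phi> :: 'a pointed_magma \<Rightarrow> 'a pointed_R_module.
    pointed_class_equivalence F_gp M_p \<Phi> \<and>
    pointed_class_equivalence F_gm M_c \<Phi>"
proof (intro exI conjI)
  let ?\<Psi> = "associated_quasigroup :: 'a pointed_R_module \<Rightarrow> 'a pointed_magma"
  let ?\<Phi> = "inv_into M_p ?\<Psi>"
  show eq: "pointed_class_equivalence F_gp M_p ?\<Phi>"
    by (rule class_equivalence_inverse[OF class_equivalence_associated_quasigroup])
  have inv: "?\<Phi> B \<in> M_p" "?\<Psi> (?\<Phi> B) = B" if "B \<in> F_gp" for B
    using associated_quasigroup_surj[OF that] by (auto simp: inv_into_into f_inv_into_f)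
  have "?\<Phi> ` F_gm = M_c"
  proof (intro equalityI subsetI)
    fix A :: "'a pointed_R_module" assume "A \<in> ?\<Phi> ` F_gm"
    then obtain B where A: "A = ?\<Phi> B" and B: "B \<in> F_gm"
      by blast
    then have "B \<in> F_gp"
      by (auto simp: F_gm_def)
    then show "A \<in> M_c"
      using inv[of B] associated_quasigroup_in_F_gm_iff[of A] A B by simp
  next
    fix A :: "'a pointed_R_module" assume "A \<in> M_c"
    then have A: "A \<in> M_p"
      by (auto simp: M_c_def)
    then have "?\<Psi> A \<in> F_gm"
      using associated_quasigroup_in_F_gm_iff \<open>A \<in> M_c\<close> by blast
    moreover have "?\<Phi> (?\<Psi> A) = A"
      using A by (simp add: associated_quasigroup_inj inv_into_f_f)
    ultimately show "A \<in> ?\<Phi> ` F_gm"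
      by (metis imageI)
  qed
  then show "pointed_class_equivalence F_gm M_c ?\<Phi>"
    by (intro class_equivalence_restrict[OF eq]) (auto simp: F_gm_def)
qed

end
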